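(* If $\rho$ is a set environment and $\Gamma;\Phi \vdash F$ is a well-formed type, then $[\![\Gamma;\Phi \vdash F]\!]^{\mathsf{Rel}}\,\mathsf{Eq}_\rho = \mathsf{Eq}_{[\![\Gamma;\Phi \vdash F]\!]^{\mathsf{Set}}\rho}$.
   Context: Types of the calculus are formed over a finite set $\Gamma$ of non-functorial (type constructor) variables and a finite set $\Phi$ of functorial variables, each variable $\phi^k$ having an arity $k$. The rules are: $\Gamma;\Phi\vdash \mathbb{0}$ and $\Gamma;\Phi\vdash\mathbb{1}$; if $\Gamma;\overline{\alpha}\vdash F$ and $\Gamma;\overline{\alpha}\vdash G$ with all $\alpha$ of arity $0$, then $\Gamma;\Phi\vdash \mathsf{Nat}^{\overline{\alpha}}F\,G$; if $\phi^k\in\Gamma\cup\Phi$ and $\Gamma;\Phi\vdash F_1,\dots,F_k$ then $\Gamma;\Phi\vdash\phi\overline{F}$; if $\Gamma;\overline{\alpha},\phi^k\vdash H$ (with $|\overline\alpha|=k$) and $\Gamma;\Phi\vdash G_1,\dots,G_k$ then $\Gamma;\Phi\vdash(\mu\phi.\lambda\overline{\alpha}.H)\overline{G}$; and sums $F+G$, products $F\times G$. A set environment maps each type variable of arity $k$ to an $\omega$-cocontinuous functor $\mathsf{Set}^k\to\mathsf{Set}$. A $k$-ary relation transformer is a triple $(F^1,F^2,F^* )$ with $F^1,F^2:\mathsf{Set}^k\to\mathsf{Set}$ and $F^*:\mathsf{Rel}^k\to\mathsf{Rel}$ $\omega$-cocontinuous, such that $F^*\overline{R}$ is a relation between $F^1\overline{A}$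 and $F^2\overline{B}$ whenever each $R_i$ relates $A_i$ and $B_i$, and $F^*$ acts on morphisms $(\alpha_i,\beta_i)$ as $(F^1\overline\alpha,F^2\overline\beta)$; a relation environment maps each variable of arity $k$ to a $k$-ary relation transformer. For a natural transformation $\alpha:F\to G$ between functors $\mathsf{Set}^k\to\mathsf{Set}$, its graph relation transformer $\langle\alpha\rangle=(F,G,\langle\alpha\rangle^* )$ sends relations $R_i\subseteq A_i\times B_i$ to the image of $F\overline{R}$ under the map $F\overline{R}\to F(\overline{A\times B})\to F\overline{A}\times G\overline{B}$ induced by $F\overline{\pi_1}$ and $\alpha_{\overline B}\circ F\overline{\pi_2}$. The equality relation transformer on $F$ is $\mathsf{Eq}_F=\langle id_F\rangle$ (for a set $A$, $\mathsf{Eq}_A$ is the usual diagonal relation), and for a set environment $\rho$ the equality relation environment $\mathsf{Eq}_\rho$ maps each variable $\phi$ to $\mathsf{Eq}_{\rho\phi}$. The set interpretation $[\![\cdot]\!]^{\mathsf{Set}}$ and relational interpretation $[\![\cdot]\!]^{\mathsf{Rel}}$ of types are defined by mutual induction: $\mathbb{0},\mathbb{1},+,\times$ are interpreted by the corresponding constructions in $\mathsf{Set}$/$\mathsf{Rel}$; $\phi\overline F$ by applying $\rho\phi$ to the interpretations of the $F$'s; $(\mu\phi.\lambda\overline\alpha.H)\overline G$ by the least fixpoint (colimit of the $\omega$-chain from the constantly-$0$ functor) of the higher-order functor $F\mapsto\lambda\overline{A}.[\![\Gamma;\phi,\overline\alpha\vdash H]\!]\rho[\phi:=F][\overline{\alpha:=A}]$,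 applied to the interpretations of the $G$'s (in $\mathsf{Rel}$, of the corresponding higher-order relation transformer); and $[\![\Gamma;\emptyset\vdash\mathsf{Nat}^{\overline\alpha}F\,G]\!]^{\mathsf{Set}}\rho$ is the set of natural transformations $\eta$ from $\lambda\overline{A}.[\![\Gamma;\overline\alpha\vdash F]\!]^{\mathsf{Set}}\rho[\overline{\alpha:=A}]$ to $\lambda\overline{A}.[\![\Gamma;\overline\alpha\vdash G]\!]^{\mathsf{Set}}\rho[\overline{\alpha:=A}]$ such that for all relations $R_i\subseteq A_i\times B_i$, $(\eta_{\overline A},\eta_{\overline B})$ maps $[\![\Gamma;\overline\alpha\vdash F]\!]^{\mathsf{Rel}}\mathsf{Eq}_\rho[\overline{\alpha:=R}]$ into $[\![\Gamma;\overline\alpha\vdash G]\!]^{\mathsf{Rel}}\mathsf{Eq}_\rho[\overline{\alpha:=R}]$, while $[\![\Gamma;\emptyset\vdash\mathsf{Nat}^{\overline\alpha}F\,G]\!]^{\mathsf{Rel}}\rho$ relates pairs $(t,t')$ of such transformations (at $\pi_1\rho$, $\pi_2\rho$) whenever for all $R_i\subseteq A_i\times B_i$, $(t_{\overline A},t'_{\overline B})$ maps $[\![\Gamma;\overline\alpha\vdash F]\!]^{\mathsf{Rel}}\rho[\overline{\alpha:=R}]$ into $[\![\Gamma;\overline\alpha\vdash G]\!]^{\mathsf{Rel}}\rho[\overline{\alpha:=R}]$. *)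

theory Defs
  imports "HOL-Library.FuncSet" "HOL-Library.Equipollence"
begin

section \<open>Types of the calculus\<close>

text \<open>
  Type constructor variables and functorial variables form two disjoint supplies.  Each variable
  is a name together with its arity.
\<close>

datatype tyvar = TCVar nat (arity: nat) | FVar nat (arity: nat)

definition TCVars :: "tyvar set" where
  "TCVars = {v. \<exists>x k. v = TCVar x k}"

definition FVars :: "tyvar set" where
  "FVars = {v. \<exists>x k. v = FVar x k}"

text \<open>\<open>TMu \<phi> \<alpha>s H Gs\<close> is the type \<open>(\<mu>\<phi>. \<lambda>\<alpha>s. H) Gs\<close>.\<close>

datatype ty =
    TZero
  | TOne
  | TNat "tyvar list" ty ty
  | TApp tyvar "ty list"
  | TMu tyvar "tyvar list" ty "ty list"
  | TSum ty ty
  | TProd ty ty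

text \<open>Tuples of pairwise distinct functorial variables of arity 0.\<close>

definition fvars0 :: "tyvar list \<Rightarrow> bool" where
  "fvars0 \<alpha>s \<longleftrightarrow> distinct \<alpha>s \<and> (\<forall>\<alpha>\<in>set \<alpha>s. \<alpha> \<in> FVars \<and> arity \<alpha> = 0)"

text \<open>
  In the rules for \<open>TNat\<close> and \<open>TMu\<close> the functorial context of the body consists of the bound
  variables only; outer functorial variables are not available there.
\<close>

inductive wf_type :: "tyvar set \<Rightarrow> tyvar set \<Rightarrow> ty \<Rightarrow> bool"  ("_; _ \<turnstile> _" [51, 51, 51] 50) where
  wf_Zero: "\<Gamma>; \<Phi> \<turnstile> TZero"
| wf_One: "\<Gamma>; \<Phi> \<turnstile> TOne"
| wf_Nat: "fvars0 \<alpha>s \<Longrightarrow> \<Gamma>; set \<alpha>s \<turnstile> F \<Longrightarrow> \<Gamma>; set \<alpha>s \<turnstile> G \<Longrightarrow> \<Gamma>; \<Phi> \<turnstile> TNat \<alpha>s F G"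
| wf_App: "\<phi> \<in> \<Gamma> \<union> \<Phi> \<Longrightarrow> length Fs = arity \<phi> \<Longrightarrow> \<forall>F\<in>set Fs. \<Gamma>; \<Phi> \<turnstile> F \<Longrightarrow> \<Gamma>; \<Phi> \<turnstile> TApp \<phi> Fs"
| wf_Mu: "fvars0 \<alpha>s \<Longrightarrow> \<phi> \<in> FVars \<Longrightarrow> \<phi> \<notin> set \<alpha>s \<Longrightarrow> arity \<phi> = length \<alpha>s \<Longrightarrow>
    \<Gamma>; insert \<phi> (set \<alpha>s) \<turnstile> H \<Longrightarrow> length Gs = length \<alpha>s \<Longrightarrow> \<forall>G\<in>set Gs. \<Gamma>; \<Phi> \<turnstile> G \<Longrightarrow>
    \<Gamma>; \<Phi> \<turnstile> TMu \<phi> \<alpha>s H Gs"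
| wf_Sum: "\<Gamma>; \<Phi> \<turnstile> F \<Longrightarrow> \<Gamma>; \<Phi> \<turnstile> G \<Longrightarrow> \<Gamma>; \<Phi> \<turnstile> TSum F G"
| wf_Prod: "\<Gamma>; \<Phi> \<turnstile> F \<Longrightarrow> \<Gamma>; \<Phi> \<turnstile> G \<Longrightarrow> \<Gamma>; \<Phi> \<turnstile> TProd F G"


section \<open>The category of sets\<close>

text \<open>
  \<open>Set\<close> is rendered as the category of small sets of a Grothendieck universe: its objects are the
  subsets of a type \<open>'u\<close> whose cardinality is below that of \<open>'u\<close>, where \<open>'u\<close> has strongly
  inaccessible cardinality (uncountable, strong limit, regular).  A universe of this kind is
  needed because function spaces and all finite iterates of them have to be objects.
\<close>

definition small :: "'u set \<Rightarrow> bool" where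
  "small A \<longleftrightarrow> A \<prec> (UNIV :: 'u set)"

definition universe :: "'u itself \<Rightarrow> bool" where
  "universe (_ :: 'u itself) \<longleftrightarrow>
     (UNIV :: nat set) \<prec> (UNIV :: 'u set) \<and>
     (\<forall>A :: 'u set. small A \<longrightarrow> Pow A \<prec> (UNIV :: 'u set)) \<and>
     (\<forall>\<A> :: 'u set set. \<A> \<prec> (UNIV :: 'u set) \<and> (\<forall>A\<in>\<A>. small A) \<longrightarrow> small (\<Union>\<A>))"

text \<open>
  Elements of \<open>'u\<close> that stand for the point, for pairs, for injections into a sum, and for the
  members of a set \<open>S\<close> of another type that is in bijection with a small set.
  The values when no suitable injection exists are irrelevant; in the last case they are chosen
  such that the image of \<open>S\<close> is always small.
\<close>

definition pt :: 'u where
  "pt = (SOME x. True)"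

definition pair :: "'u \<times> 'u \<Rightarrow> 'u" where
  "pair = (SOME f. inj f)"

definition tag :: "'u + 'u \<Rightarrow> 'u" where
  "tag = (SOME f. inj f)"

definition code :: "'b set \<Rightarrow> 'b \<Rightarrow> 'u" where
  "code S = (if \<exists>f :: 'b \<Rightarrow> 'u. inj_on f S \<and> small (f ` S)
             then (SOME f. inj_on f S \<and> small (f ` S)) else (\<lambda>_. pt))"

text \<open>
  Objects and morphisms of \<open>Set\<^sup>k\<close> are lists.  A function from \<open>A\<close> to \<open>B\<close> is an element of
  \<open>A \<rightarrow>\<^sub>E B\<close>, so that morphisms are equal iff they agree on their domain.
\<close>

definition Obj :: "nat \<Rightarrow> 'u set list set" where
  "Obj k = {As. length As = k \<and> (\<forall>A\<in>set As. small A)}"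

definition Hom :: "'u set list \<Rightarrow> 'u set list \<Rightarrow> ('u \<Rightarrow> 'u) list set" where
  "Hom As Bs = {fs. length fs = length As \<and> length Bs = length As \<and>
                    (\<forall>i<length As. fs ! i \<in> As ! i \<rightarrow>\<^sub>E Bs ! i)}"

definition ident :: "'u set \<Rightarrow> 'u \<Rightarrow> 'u" where
  "ident A = (\<lambda>x\<in>A. x)"

definition comps :: "'u set list \<Rightarrow> ('u \<Rightarrow> 'u) list \<Rightarrow> ('u \<Rightarrow> 'u) list \<Rightarrow> ('u \<Rightarrow> 'u) list" where
  "comps As gs fs = map (\<lambda>i. compose (As ! i) (gs ! i) (fs ! i)) [0..<length As]"


subsection \<open>Functors and natural transformations\<close>

text \<open>\<open>fmap F As Bs fs\<close> is the action of \<open>F\<close> on the morphism \<open>fs\<close> from \<open>As\<close> to \<open>Bs\<close>.\<close>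

datatype 'u setfun = SetFun
  (fobj: "'u set list \<Rightarrow> 'u set")
  (fmap: "'u set list \<Rightarrow> 'u set list \<Rightarrow> ('u \<Rightarrow> 'u) list \<Rightarrow> 'u \<Rightarrow> 'u")

definition is_functor :: "nat \<Rightarrow> 'u setfun \<Rightarrow> bool" where
  "is_functor k F \<longleftrightarrow>
     (\<forall>As\<in>Obj k. small (fobj F As)) \<and>
     (\<forall>As\<in>Obj k. \<forall>Bs\<in>Obj k. \<forall>fs\<in>Hom As Bs. fmap F As Bs fs \<in> fobj F As \<rightarrow>\<^sub>E fobj F Bs) \<and>
     (\<forall>As\<in>Obj k. fmap F As As (map ident As) = ident (fobj F As)) \<and>
     (\<forall>As\<in>Obj k. \<forall>Bs\<in>Obj k. \<forall>Cs\<in>Obj k. \<forall>fs\<in>Hom As Bs. \<forall>gs\<in>Hom Bs Cs.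
        fmap F As Cs (comps As gs fs) = compose (fobj F As) (fmap F Bs Cs gs) (fmap F As Bs fs))"

definition is_chain :: "nat \<Rightarrow> (nat \<Rightarrow> 'u set list) \<Rightarrow> (nat \<Rightarrow> ('u \<Rightarrow> 'u) list) \<Rightarrow> bool" where
  "is_chain k As fs \<longleftrightarrow> (\<forall>n. As n \<in> Obj k \<and> fs n \<in> Hom (As n) (As (Suc n)))"

definition is_cocone ::
  "nat \<Rightarrow> (nat \<Rightarrow> 'u set list) \<Rightarrow> (nat \<Rightarrow> ('u \<Rightarrow> 'u) list) \<Rightarrow> 'u set list \<Rightarrow> (nat \<Rightarrow> ('u \<Rightarrow> 'u) list) \<Rightarrow> bool"
where
  "is_cocone k As fs C cs \<longleftrightarrow>
     C \<in> Obj k \<and> (\<forall>n. cs n \<in> Hom (As n) C \<and> comps (As n) (cs (Suc n)) (fs n) = cs n)"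

definition is_colimit ::
  "nat \<Rightarrow> (nat \<Rightarrow> 'u set list) \<Rightarrow> (nat \<Rightarrow> ('u \<Rightarrow> 'u) list) \<Rightarrow> 'u set list \<Rightarrow> (nat \<Rightarrow> ('u \<Rightarrow> 'u) list) \<Rightarrow> bool"
where
  "is_colimit k As fs C cs \<longleftrightarrow> is_cocone k As fs C cs \<and>
     (\<forall>D ds. is_cocone k As fs D ds \<longrightarrow> (\<exists>!hs. hs \<in> Hom C D \<and> (\<forall>n. comps (As n) hs (cs n) = ds n)))"

text \<open>Preservation of the colimits of all \<open>\<omega>\<close>-chains; the image cocone lives in \<open>Set\<^sup>1\<close>.\<close>

definition omega_cocontinuous :: "nat \<Rightarrow> 'u setfun \<Rightarrow> bool" where
  "omega_cocontinuous k F \<longleftrightarrow>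
     (\<forall>As fs C cs. is_chain k As fs \<and> is_colimit k As fs C cs \<longrightarrow>
        is_colimit 1 (\<lambda>n. [fobj F (As n)]) (\<lambda>n. [fmap F (As n) (As (Suc n)) (fs n)])
                     [fobj F C] (\<lambda>n. [fmap F (As n) C (cs n)]))"

text \<open>The component of a transformation \<open>\<eta>\<close> at \<open>As\<close> is \<open>\<eta> As\<close>.\<close>

type_synonym 'u nt = "'u set list \<Rightarrow> 'u \<Rightarrow> 'u"

definition nat_trans :: "nat \<Rightarrow> 'u setfun \<Rightarrow> 'u setfun \<Rightarrow> 'u nt set" where
  "nat_trans k F G =
     {\<eta> \<in> (\<Pi>\<^sub>E As\<in>Obj k. fobj F As \<rightarrow>\<^sub>E fobj G As).
        \<forall>As\<in>Obj k. \<forall>Bs\<in>Obj k. \<forall>fs\<in>Hom As Bs.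
          compose (fobj F As) (fmap G As Bs fs) (\<eta> As) = compose (fobj F As) (\<eta> Bs) (fmap F As Bs fs)}"

definition id_nt :: "'u setfun \<Rightarrow> 'u nt" where
  "id_nt F = (\<lambda>As. ident (fobj F As))"

text \<open>The constantly \<open>0\<close> functor, and a set seen as a functor on \<open>Set\<^sup>0\<close>.\<close>

definition K0 :: "'u setfun" where
  "K0 = SetFun (\<lambda>As. {}) (\<lambda>As Bs fs. ident {})"

definition cst :: "'u set \<Rightarrow> 'u setfun" where
  "cst A = SetFun (\<lambda>As. A) (\<lambda>As Bs fs. ident A)"


subsection \<open>Colimits of \<open>\<omega>\<close>-chains of sets\<close>

primrec shift :: "(nat \<Rightarrow> 'u \<Rightarrow> 'u) \<Rightarrow> nat \<Rightarrow> nat \<Rightarrow> 'u \<Rightarrow> 'u" where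
  "shift f n 0 x = x"
| "shift f n (Suc d) x = f (n + d) (shift f n d x)"

definition colim_eq :: "(nat \<Rightarrow> 'u set) \<Rightarrow> (nat \<Rightarrow> 'u \<Rightarrow> 'u) \<Rightarrow> ((nat \<times> 'u) \<times> (nat \<times> 'u)) set" where
  "colim_eq A f = {((m, x), (n, y)) | m x n y.
     x \<in> A m \<and> y \<in> A n \<and> (\<exists>d e. m + d = n + e \<and> shift f m d x = shift f n e y)}"

definition colim_classes :: "(nat \<Rightarrow> 'u set) \<Rightarrow> (nat \<Rightarrow> 'u \<Rightarrow> 'u) \<Rightarrow> (nat \<times> 'u) set set" where
  "colim_classes A f = (SIGMA n:UNIV. A n) // colim_eq A f"

definition colim :: "(nat \<Rightarrow> 'u set) \<Rightarrow> (nat \<Rightarrow> 'u \<Rightarrow> 'u) \<Rightarrow> 'u set" where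
  "colim A f = code (colim_classes A f) ` colim_classes A f"

definition colim_in :: "(nat \<Rightarrow> 'u set) \<Rightarrow> (nat \<Rightarrow> 'u \<Rightarrow> 'u) \<Rightarrow> nat \<Rightarrow> 'u \<Rightarrow> 'u" where
  "colim_in A f n = (\<lambda>x\<in>A n. code (colim_classes A f) (colim_eq A f `` {(n, x)}))"

text \<open>The map between colimits induced by a morphism \<open>h\<close> of chains.\<close>

definition colim_map ::
  "(nat \<Rightarrow> 'u set) \<Rightarrow> (nat \<Rightarrow> 'u \<Rightarrow> 'u) \<Rightarrow> (nat \<Rightarrow> 'u set) \<Rightarrow> (nat \<Rightarrow> 'u \<Rightarrow> 'u) \<Rightarrow> (nat \<Rightarrow> 'u \<Rightarrow> 'u) \<Rightarrow> 'u \<Rightarrow> 'u"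
where
  "colim_map A f B g h = (\<lambda>c\<in>colim A f.
     THE d. \<exists>n. \<exists>x\<in>A n. c = colim_in A f n x \<and> d = colim_in B g n (h n x))"


section \<open>Relations and relation transformers\<close>

text \<open>\<open>Rel A B R\<close> is the relation \<open>R \<subseteq> A \<times> B\<close> together with its domain and codomain.\<close>

datatype 'u relobj = Rel (rdom: "'u set") (rcod: "'u set") (graph: "('u \<times> 'u) set")

definition RelObj :: "nat \<Rightarrow> 'u relobj list set" where
  "RelObj k = {Rs. length Rs = k \<and>
     (\<forall>R\<in>set Rs. small (rdom R) \<and> small (rcod R) \<and> graph R \<subseteq> rdom R \<times> rcod R)}"

definition Eq_set :: "'u set \<Rightarrow> 'u relobj" where
  "Eq_set A = Rel A A (Id_on A)"

text \<open>\<open>(f, g)\<close> is a morphism of relations: it maps related elements to related elements.\<close>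

definition preserves :: "('u \<Rightarrow> 'u) \<Rightarrow> ('u \<Rightarrow> 'u) \<Rightarrow> 'u relobj \<Rightarrow> 'u relobj \<Rightarrow> bool" where
  "preserves f g R S \<longleftrightarrow> (\<forall>(x, y)\<in>graph R. (f x, g y) \<in> graph S)"

text \<open>
  The data \<open>(F\<^sup>1, F\<^sup>2, F\<^sup>*)\<close> of a relation transformer.  The action of \<open>F\<^sup>*\<close> on morphisms is
  determined by \<open>F\<^sup>1\<close> and \<open>F\<^sup>2\<close>, so only the action on objects is recorded.
\<close>

datatype 'u rtrans = RTrans (tr1: "'u setfun") (tr2: "'u setfun") (star: "'u relobj list \<Rightarrow> 'u relobj")

definition K0_rel :: "'u rtrans" where
  "K0_rel = RTrans K0 K0 (\<lambda>Rs. Rel {} {} {})"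

definition cst_rel :: "'u relobj \<Rightarrow> 'u rtrans" where
  "cst_rel R = RTrans (cst (rdom R)) (cst (rcod R)) (\<lambda>Rs. R)"

text \<open>
  To apply a functor to a relation, the relation has to be a set of elements of \<open>'u\<close>;
  \<open>tabulate R\<close> is this set, with projections \<open>proj1 R\<close> and \<open>proj2 R\<close>.
\<close>

definition tabulate :: "'u relobj \<Rightarrow> 'u set" where
  "tabulate R = pair ` graph R"

definition proj1 :: "'u relobj \<Rightarrow> 'u \<Rightarrow> 'u" where
  "proj1 R = (\<lambda>z\<in>tabulate R. fst (inv pair z))"

definition proj2 :: "'u relobj \<Rightarrow> 'u \<Rightarrow> 'u" where
  "proj2 R = (\<lambda>z\<in>tabulate R. snd (inv pair z))"

definition graph_rtrans :: "'u setfun \<Rightarrow> 'u setfun \<Rightarrow> 'u nt \<Rightarrow> 'u rtrans" where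
  "graph_rtrans F G \<alpha> = RTrans F G (\<lambda>Rs.
     let As = map rdom Rs; Bs = map rcod Rs; Ts = map tabulate Rs in
     Rel (fobj F As) (fobj G Bs)
       ((\<lambda>z. (fmap F Ts As (map proj1 Rs) z, \<alpha> Bs (fmap F Ts Bs (map proj2 Rs) z))) ` fobj F Ts))"

definition Eq_fun :: "'u setfun \<Rightarrow> 'u rtrans" where
  "Eq_fun F = graph_rtrans F F (id_nt F)"


section \<open>Environments\<close>

type_synonym 'u setenv = "tyvar \<Rightarrow> 'u setfun"
type_synonym 'u relenv = "tyvar \<Rightarrow> 'u rtrans"

text \<open>Morphisms of set environments: a family of transformations, one for each variable.\<close>

type_synonym 'u envmor = "tyvar \<Rightarrow> 'u nt"

definition set_env :: "'u setenv \<Rightarrow> bool" where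
  "set_env \<rho> \<longleftrightarrow> (\<forall>\<phi>. is_functor (arity \<phi>) (\<rho> \<phi>) \<and> omega_cocontinuous (arity \<phi>) (\<rho> \<phi>))"

definition Eq_env :: "'u setenv \<Rightarrow> 'u relenv" where
  "Eq_env \<rho> = (\<lambda>\<phi>. Eq_fun (\<rho> \<phi>))"

definition env1 :: "'u relenv \<Rightarrow> 'u setenv" where
  "env1 \<sigma> = (\<lambda>\<phi>. tr1 (\<sigma> \<phi>))"

definition env2 :: "'u relenv \<Rightarrow> 'u setenv" where
  "env2 \<sigma> = (\<lambda>\<phi>. tr2 (\<sigma> \<phi>))"

definition id_env :: "'u setenv \<Rightarrow> 'u envmor" where
  "id_env \<rho> = (\<lambda>\<phi>. id_nt (\<rho> \<phi>))"

definition upds :: "(tyvar \<Rightarrow> 'b) \<Rightarrow> tyvar list \<Rightarrow> 'b list \<Rightarrow> tyvar \<Rightarrow> 'b" where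
  "upds \<rho> \<alpha>s xs = (\<lambda>v. if v \<in> set \<alpha>s then the (map_of (zip \<alpha>s xs) v) else \<rho> v)"

text \<open>Extensions by sets, by relations and by functions for variables of arity 0.\<close>

definition ext_set :: "'u setenv \<Rightarrow> tyvar list \<Rightarrow> 'u set list \<Rightarrow> 'u setenv" where
  "ext_set \<rho> \<alpha>s As = upds \<rho> \<alpha>s (map cst As)"

definition ext_rel :: "'u relenv \<Rightarrow> tyvar list \<Rightarrow> 'u relobj list \<Rightarrow> 'u relenv" where
  "ext_rel \<sigma> \<alpha>s Rs = upds \<sigma> \<alpha>s (map cst_rel Rs)"

definition ext_mor :: "'u envmor \<Rightarrow> tyvar list \<Rightarrow> ('u \<Rightarrow> 'u) list \<Rightarrow> 'u envmor" where
  "ext_mor f \<alpha>s gs = upds f \<alpha>s (map (\<lambda>g As. g) gs)"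


section \<open>Semantic counterparts of the type constructors\<close>

text \<open>
  Below, the arguments \<open>h\<close>, \<open>m\<close>, \<open>r\<close> are the three components of the interpretation of a type:
  its set interpretation on environments, its set interpretation on morphisms of environments
  (\<open>m \<rho> \<rho>' f\<close> with \<open>f\<close> from \<open>\<rho>\<close> to \<open>\<rho>'\<close>), and its relational interpretation.
\<close>

type_synonym 'u sem_obj = "'u setenv \<Rightarrow> 'u set"
type_synonym 'u sem_mor = "'u setenv \<Rightarrow> 'u setenv \<Rightarrow> 'u envmor \<Rightarrow> 'u \<Rightarrow> 'u"
type_synonym 'u sem_rel = "'u relenv \<Rightarrow> 'u relobj"

text \<open>The functor \<open>\<lambda>As. h \<rho>[\<alpha>s := As]\<close>.\<close>

definition lam :: "tyvar list \<Rightarrow> 'u sem_obj \<Rightarrow> 'u sem_mor \<Rightarrow> 'u setenv \<Rightarrow> 'u setfun" where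
  "lam \<alpha>s h m \<rho> = SetFun
     (\<lambda>As. h (ext_set \<rho> \<alpha>s As))
     (\<lambda>As Bs fs. m (ext_set \<rho> \<alpha>s As) (ext_set \<rho> \<alpha>s Bs) (ext_mor (id_env \<rho>) \<alpha>s fs))"


subsection \<open>Natural transformations\<close>

definition Nat_preserving ::
  "tyvar list \<Rightarrow> 'u sem_rel \<Rightarrow> 'u sem_rel \<Rightarrow> 'u relenv \<Rightarrow> 'u nt \<Rightarrow> 'u nt \<Rightarrow> bool"
where
  "Nat_preserving \<alpha>s r r' \<sigma> t t' \<longleftrightarrow> (\<forall>Rs\<in>RelObj (length \<alpha>s).
     preserves (t (map rdom Rs)) (t' (map rcod Rs)) (r (ext_rel \<sigma> \<alpha>s Rs)) (r' (ext_rel \<sigma> \<alpha>s Rs)))"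

definition Nat_family ::
  "tyvar list \<Rightarrow> 'u sem_obj \<Rightarrow> 'u sem_mor \<Rightarrow> 'u sem_rel \<Rightarrow> 'u sem_obj \<Rightarrow> 'u sem_mor \<Rightarrow> 'u sem_rel
   \<Rightarrow> 'u setenv \<Rightarrow> 'u nt set"
where
  "Nat_family \<alpha>s h m r h' m' r' \<rho> =
     {\<eta> \<in> nat_trans (length \<alpha>s) (lam \<alpha>s h m \<rho>) (lam \<alpha>s h' m' \<rho>). Nat_preserving \<alpha>s r r' (Eq_env \<rho>) \<eta> \<eta>}"

text \<open>
  Natural transformations are indexed by all tuples of small sets, so they become elements of
  \<open>'u\<close> only via \<open>code\<close>.  A natural transformation between finitary functors is determined by
  its components at tuples of finite subsets of a fixed countable set; hence there is only a small
  set of them, and \<open>code\<close> is injective on it.  (Functors that preserve colimits of \<open>\<omega>\<close>-chains of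
  small sets are finitary, unless there is a measurable cardinal below the cardinality of \<open>'u\<close>.)
\<close>

definition Nat_set ::
  "tyvar list \<Rightarrow> 'u sem_obj \<Rightarrow> 'u sem_mor \<Rightarrow> 'u sem_rel \<Rightarrow> 'u sem_obj \<Rightarrow> 'u sem_mor \<Rightarrow> 'u sem_rel
   \<Rightarrow> 'u setenv \<Rightarrow> 'u set"
where
  "Nat_set \<alpha>s h m r h' m' r' \<rho> =
     (let N = Nat_family \<alpha>s h m r h' m' r' \<rho> in code N ` N)"

definition Nat_rel ::
  "tyvar list \<Rightarrow> 'u sem_obj \<Rightarrow> 'u sem_mor \<Rightarrow> 'u sem_rel \<Rightarrow> 'u sem_obj \<Rightarrow> 'u sem_mor \<Rightarrow> 'u sem_rel
   \<Rightarrow> 'u relenv \<Rightarrow> 'u relobj"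
where
  "Nat_rel \<alpha>s h m r h' m' r' \<sigma> =
     (let N1 = Nat_family \<alpha>s h m r h' m' r' (env1 \<sigma>);
          N2 = Nat_family \<alpha>s h m r h' m' r' (env2 \<sigma>)
      in Rel (code N1 ` N1) (code N2 ` N2)
           {(code N1 t, code N2 t') | t t'. t \<in> N1 \<and> t' \<in> N2 \<and> Nat_preserving \<alpha>s r r' \<sigma> t t'})"


subsection \<open>Least fixpoints\<close>

text \<open>
  The higher-order functor \<open>T \<rho> F = (\<lambda>As. h \<rho>[\<phi> := F][\<alpha>s := As])\<close>, and its action on a
  transformation \<open>\<nu>\<close> from \<open>F\<close> to \<open>F'\<close>, combined with a morphism \<open>f\<close> from \<open>\<rho>\<close> to \<open>\<rho>'\<close>, which
  yields a transformation from \<open>T \<rho> F\<close> to \<open>T \<rho>' F'\<close>.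
\<close>

definition T_obj :: "tyvar \<Rightarrow> tyvar list \<Rightarrow> 'u sem_obj \<Rightarrow> 'u sem_mor \<Rightarrow> 'u setenv \<Rightarrow> 'u setfun \<Rightarrow> 'u setfun"
where
  "T_obj \<phi> \<alpha>s h m \<rho> F = lam \<alpha>s h m (\<rho>(\<phi> := F))"

definition T_map ::
  "tyvar \<Rightarrow> tyvar list \<Rightarrow> 'u sem_mor \<Rightarrow> 'u setenv \<Rightarrow> 'u setenv \<Rightarrow> 'u envmor
   \<Rightarrow> 'u setfun \<Rightarrow> 'u setfun \<Rightarrow> 'u nt \<Rightarrow> 'u nt"
where
  "T_map \<phi> \<alpha>s m \<rho> \<rho>' f F F' \<nu> = (\<lambda>As.
     m (ext_set (\<rho>(\<phi> := F)) \<alpha>s As) (ext_set (\<rho>'(\<phi> := F')) \<alpha>s As) (ext_mor (f(\<phi> := \<nu>)) \<alpha>s (map ident As)))"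

text \<open>The functors \<open>T\<^sup>n 0\<close>, and the transformations from \<open>T\<^sup>n 0\<close> to \<open>T\<^bsup>n+1\<^esup> 0\<close> that link them.\<close>

definition T_iter :: "tyvar \<Rightarrow> tyvar list \<Rightarrow> 'u sem_obj \<Rightarrow> 'u sem_mor \<Rightarrow> 'u setenv \<Rightarrow> nat \<Rightarrow> 'u setfun" where
  "T_iter \<phi> \<alpha>s h m \<rho> n = (T_obj \<phi> \<alpha>s h m \<rho> ^^ n) K0"

primrec T_link :: "tyvar \<Rightarrow> tyvar list \<Rightarrow> 'u sem_obj \<Rightarrow> 'u sem_mor \<Rightarrow> 'u setenv \<Rightarrow> nat \<Rightarrow> 'u nt" where
  "T_link \<phi> \<alpha>s h m \<rho> 0 = id_nt K0"
| "T_link \<phi> \<alpha>s h m \<rho> (Suc n) = T_map \<phi> \<alpha>s m \<rho> \<rho> (id_env \<rho>)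
     (T_iter \<phi> \<alpha>s h m \<rho> n) (T_iter \<phi> \<alpha>s h m \<rho> (Suc n)) (T_link \<phi> \<alpha>s h m \<rho> n)"

text \<open>The transformations from \<open>T\<^sup>n 0\<close> at \<open>\<rho>\<close> to \<open>T\<^sup>n 0\<close> at \<open>\<rho>'\<close> induced by a morphism \<open>f\<close>.\<close>

primrec T_env ::
  "tyvar \<Rightarrow> tyvar list \<Rightarrow> 'u sem_obj \<Rightarrow> 'u sem_mor \<Rightarrow> 'u setenv \<Rightarrow> 'u setenv \<Rightarrow> 'u envmor \<Rightarrow> nat \<Rightarrow> 'u nt"
where
  "T_env \<phi> \<alpha>s h m \<rho> \<rho>' f 0 = id_nt K0"
| "T_env \<phi> \<alpha>s h m \<rho> \<rho>' f (Suc n) = T_map \<phi> \<alpha>s m \<rho> \<rho>' f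
     (T_iter \<phi> \<alpha>s h m \<rho> n) (T_iter \<phi> \<alpha>s h m \<rho>' n) (T_env \<phi> \<alpha>s h m \<rho> \<rho>' f n)"

definition Mu_in ::
  "tyvar \<Rightarrow> tyvar list \<Rightarrow> 'u sem_obj \<Rightarrow> 'u sem_mor \<Rightarrow> 'u setenv \<Rightarrow> 'u set list \<Rightarrow> nat \<Rightarrow> 'u \<Rightarrow> 'u"
where
  "Mu_in \<phi> \<alpha>s h m \<rho> As =
     colim_in (\<lambda>n. fobj (T_iter \<phi> \<alpha>s h m \<rho> n) As) (\<lambda>n. T_link \<phi> \<alpha>s h m \<rho> n As)"

definition Mu_fun :: "tyvar \<Rightarrow> tyvar list \<Rightarrow> 'u sem_obj \<Rightarrow> 'u sem_mor \<Rightarrow> 'u setenv \<Rightarrow> 'u setfun" where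
  "Mu_fun \<phi> \<alpha>s h m \<rho> = SetFun
     (\<lambda>As. colim (\<lambda>n. fobj (T_iter \<phi> \<alpha>s h m \<rho> n) As) (\<lambda>n. T_link \<phi> \<alpha>s h m \<rho> n As))
     (\<lambda>As Bs fs. colim_map
        (\<lambda>n. fobj (T_iter \<phi> \<alpha>s h m \<rho> n) As) (\<lambda>n. T_link \<phi> \<alpha>s h m \<rho> n As)
        (\<lambda>n. fobj (T_iter \<phi> \<alpha>s h m \<rho> n) Bs) (\<lambda>n. T_link \<phi> \<alpha>s h m \<rho> n Bs)
        (\<lambda>n. fmap (T_iter \<phi> \<alpha>s h m \<rho> n) As Bs fs))"

definition Mu_env ::
  "tyvar \<Rightarrow> tyvar list \<Rightarrow> 'u sem_obj \<Rightarrow> 'u sem_mor \<Rightarrow> 'u setenv \<Rightarrow> 'u setenv \<Rightarrow> 'u envmor \<Rightarrow> 'u nt"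
where
  "Mu_env \<phi> \<alpha>s h m \<rho> \<rho>' f = (\<lambda>As. colim_map
     (\<lambda>n. fobj (T_iter \<phi> \<alpha>s h m \<rho> n) As) (\<lambda>n. T_link \<phi> \<alpha>s h m \<rho> n As)
     (\<lambda>n. fobj (T_iter \<phi> \<alpha>s h m \<rho>' n) As) (\<lambda>n. T_link \<phi> \<alpha>s h m \<rho>' n As)
     (\<lambda>n. T_env \<phi> \<alpha>s h m \<rho> \<rho>' f n As))"

text \<open>
  The corresponding higher-order relation transformer.  The colimit of a chain of relations
  \<open>R\<^sub>n\<close> between \<open>A\<^sub>n\<close> and \<open>B\<^sub>n\<close> in the category of relations relates the colimits of the \<open>A\<^sub>n\<close>
  and of the \<open>B\<^sub>n\<close>; it is the union of the images of the \<open>R\<^sub>n\<close> under the colimit injections.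
\<close>

definition T_rel ::
  "tyvar \<Rightarrow> tyvar list \<Rightarrow> 'u sem_obj \<Rightarrow> 'u sem_mor \<Rightarrow> 'u sem_rel \<Rightarrow> 'u relenv \<Rightarrow> 'u rtrans \<Rightarrow> 'u rtrans"
where
  "T_rel \<phi> \<alpha>s h m r \<sigma> F = RTrans
     (T_obj \<phi> \<alpha>s h m (env1 \<sigma>) (tr1 F))
     (T_obj \<phi> \<alpha>s h m (env2 \<sigma>) (tr2 F))
     (\<lambda>Rs. r (ext_rel (\<sigma>(\<phi> := F)) \<alpha>s Rs))"

definition Mu_rel ::
  "tyvar \<Rightarrow> tyvar list \<Rightarrow> 'u sem_obj \<Rightarrow> 'u sem_mor \<Rightarrow> 'u sem_rel \<Rightarrow> 'u relenv \<Rightarrow> 'u rtrans"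
where
  "Mu_rel \<phi> \<alpha>s h m r \<sigma> = RTrans
     (Mu_fun \<phi> \<alpha>s h m (env1 \<sigma>))
     (Mu_fun \<phi> \<alpha>s h m (env2 \<sigma>))
     (\<lambda>Rs. Rel
        (fobj (Mu_fun \<phi> \<alpha>s h m (env1 \<sigma>)) (map rdom Rs))
        (fobj (Mu_fun \<phi> \<alpha>s h m (env2 \<sigma>)) (map rcod Rs))
        (\<Union>n. map_prod (Mu_in \<phi> \<alpha>s h m (env1 \<sigma>) (map rdom Rs) n) (Mu_in \<phi> \<alpha>s h m (env2 \<sigma>) (map rcod Rs) n)
                ` graph (star ((T_rel \<phi> \<alpha>s h m r \<sigma> ^^ n) K0_rel) Rs)))"


section \<open>Interpretation of types\<close>

text \<open>
  \<open>set_sem F \<rho>\<close> and \<open>set_mor F \<rho> \<rho>' f\<close> are the action of the set interpretation on objects and on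
  morphisms of set environments, \<open>rel_sem F \<sigma>\<close> is the relational interpretation.
  Environment morphisms are identities on the type constructor variables, so those of \<open>TNat\<close>,
  where no functorial variable is free, act as identities.
\<close>

fun set_sem :: "ty \<Rightarrow> 'u setenv \<Rightarrow> 'u set"
  and set_mor :: "ty \<Rightarrow> 'u setenv \<Rightarrow> 'u setenv \<Rightarrow> 'u envmor \<Rightarrow> 'u \<Rightarrow> 'u"
  and rel_sem :: "ty \<Rightarrow> 'u relenv \<Rightarrow> 'u relobj"
where
  "set_sem TZero \<rho> = {}"
| "set_sem TOne \<rho> = {pt}"
| "set_sem (TNat \<alpha>s F G) \<rho> =
     Nat_set \<alpha>s (\<lambda>\<rho>. set_sem F \<rho>) (\<lambda>\<rho> \<rho>' f. set_mor F \<rho> \<rho>' f) (\<lambda>\<sigma>. rel_sem F \<sigma>)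
                (\<lambda>\<rho>. set_sem G \<rho>) (\<lambda>\<rho> \<rho>' f. set_mor G \<rho> \<rho>' f) (\<lambda>\<sigma>. rel_sem G \<sigma>) \<rho>"
| "set_sem (TApp \<phi> Fs) \<rho> = fobj (\<rho> \<phi>) (map (\<lambda>F. set_sem F \<rho>) Fs)"
| "set_sem (TMu \<phi> \<alpha>s H Gs) \<rho> =
     fobj (Mu_fun \<phi> \<alpha>s (\<lambda>\<rho>. set_sem H \<rho>) (\<lambda>\<rho> \<rho>' f. set_mor H \<rho> \<rho>' f) \<rho>) (map (\<lambda>G. set_sem G \<rho>) Gs)"
| "set_sem (TSum F G) \<rho> = tag ` (set_sem F \<rho> <+> set_sem G \<rho>)"
| "set_sem (TProd F G) \<rho> = pair ` (set_sem F \<rho> \<times> set_sem G \<rho>)"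

| "set_mor TZero \<rho> \<rho>' f = ident {}"
| "set_mor TOne \<rho> \<rho>' f = ident {pt}"
| "set_mor (TNat \<alpha>s F G) \<rho> \<rho>' f = ident
     (Nat_set \<alpha>s (\<lambda>\<rho>. set_sem F \<rho>) (\<lambda>\<rho> \<rho>' f. set_mor F \<rho> \<rho>' f) (\<lambda>\<sigma>. rel_sem F \<sigma>)
                (\<lambda>\<rho>. set_sem G \<rho>) (\<lambda>\<rho> \<rho>' f. set_mor G \<rho> \<rho>' f) (\<lambda>\<sigma>. rel_sem G \<sigma>) \<rho>)"
| "set_mor (TApp \<phi> Fs) \<rho> \<rho>' f =
     (let As = map (\<lambda>F. set_sem F \<rho>) Fs; Bs = map (\<lambda>F. set_sem F \<rho>') Fs
      in compose (fobj (\<rho> \<phi>) As) (f \<phi> Bs) (fmap (\<rho> \<phi>) As Bs (map (\<lambda>F. set_mor F \<rho> \<rho>' f) Fs)))"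
| "set_mor (TMu \<phi> \<alpha>s H Gs) \<rho> \<rho>' f =
     (let M = Mu_fun \<phi> \<alpha>s (\<lambda>\<rho>. set_sem H \<rho>) (\<lambda>\<rho> \<rho>' f. set_mor H \<rho> \<rho>' f) \<rho>;
          As = map (\<lambda>G. set_sem G \<rho>) Gs; Bs = map (\<lambda>G. set_sem G \<rho>') Gs
      in compose (fobj M As)
           (Mu_env \<phi> \<alpha>s (\<lambda>\<rho>. set_sem H \<rho>) (\<lambda>\<rho> \<rho>' f. set_mor H \<rho> \<rho>' f) \<rho> \<rho>' f Bs)
           (fmap M As Bs (map (\<lambda>G. set_mor G \<rho> \<rho>' f) Gs)))"
| "set_mor (TSum F G) \<rho> \<rho>' f =
     (\<lambda>z\<in>tag ` (set_sem F \<rho> <+> set_sem G \<rho>).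
        tag (map_sum (set_mor F \<rho> \<rho>' f) (set_mor G \<rho> \<rho>' f) (inv tag z)))"
| "set_mor (TProd F G) \<rho> \<rho>' f =
     (\<lambda>z\<in>pair ` (set_sem F \<rho> \<times> set_sem G \<rho>).
        pair (map_prod (set_mor F \<rho> \<rho>' f) (set_mor G \<rho> \<rho>' f) (inv pair z)))"

| "rel_sem TZero \<sigma> = Rel {} {} {}"
| "rel_sem TOne \<sigma> = Rel {pt} {pt} {(pt, pt)}"
| "rel_sem (TNat \<alpha>s F G) \<sigma> =
     Nat_rel \<alpha>s (\<lambda>\<rho>. set_sem F \<rho>) (\<lambda>\<rho> \<rho>' f. set_mor F \<rho> \<rho>' f) (\<lambda>\<sigma>. rel_sem F \<sigma>)
                (\<lambda>\<rho>. set_sem G \<rho>) (\<lambda>\<rho> \<rho>' f. set_mor G \<rho> \<rho>' f) (\<lambda>\<sigma>. rel_sem G \<sigma>) \<sigma>"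
| "rel_sem (TApp \<phi> Fs) \<sigma> = star (\<sigma> \<phi>) (map (\<lambda>F. rel_sem F \<sigma>) Fs)"
| "rel_sem (TMu \<phi> \<alpha>s H Gs) \<sigma> =
     star (Mu_rel \<phi> \<alpha>s (\<lambda>\<rho>. set_sem H \<rho>) (\<lambda>\<rho> \<rho>' f. set_mor H \<rho> \<rho>' f) (\<lambda>\<sigma>. rel_sem H \<sigma>) \<sigma>)
          (map (\<lambda>G. rel_sem G \<sigma>) Gs)"
| "rel_sem (TSum F G) \<sigma> =
     (let R = rel_sem F \<sigma>; S = rel_sem G \<sigma>
      in Rel (tag ` (rdom R <+> rdom S)) (tag ` (rcod R <+> rcod S))
           ({(tag (Inl x), tag (Inl y)) | x y. (x, y) \<in> graph R} \<union>
            {(tag (Inr x), tag (Inr y)) | x y. (x, y) \<in> graph S}))"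
| "rel_sem (TProd F G) \<sigma> =
     (let R = rel_sem F \<sigma>; S = rel_sem G \<sigma>
      in Rel (pair ` (rdom R \<times> rdom S)) (pair ` (rcod R \<times> rcod S))
           {(pair (x, x'), pair (y, y')) | x x' y y'. (x, y) \<in> graph R \<and> (x', y') \<in> graph S})"

end

theory Submission
  imports Defs
begin

text \<open>
  The fixpoint case prevents a direct induction: there the body of \<open>\<mu>\<phi>. \<lambda>\<alpha>s. H\<close> is interpreted in
  an environment sending \<open>\<phi>\<close> to an iterate of the relation transformer, which agrees with the
  equality transformer of the corresponding iterate of the functor on equality relations only.
  Since a functorial variable is never free in a type \<open>Nat\<close>, this weaker agreement
  suffices for functorial variables, while true equality is kept for the type constructor variables.
\<close>

section \<open>Small sets\<close>

lemma small_image: "small (A :: 'u set) \<Longrightarrow> small ((f :: 'u \<Rightarrow> 'u) ` A)"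
  unfolding small_def by (rule lesspoll_trans1[OF image_lepoll])

lemma infinite_UNIV_universe:
  assumes "universe TYPE('u)"
  shows "infinite (UNIV :: 'u set)"
proof -
  have "(UNIV :: nat set) \<lesssim> (UNIV :: 'u set)"
    using assms unfolding universe_def by (blast intro: lesspoll_imp_lepoll)
  then show ?thesis
    unfolding infinite_le_lepoll .
qed

lemma small_finite:
  assumes "universe TYPE('u)" "finite (A :: 'u set)"
  shows "small A"
  unfolding small_def
  by (rule finite_lesspoll_infinite[OF infinite_UNIV_universe[OF assms(1)] assms(2)])

lemma small_UN:
  fixes B :: "'u \<Rightarrow> 'u set"
  assumes U: "universe TYPE('u)" and A: "small A" and B: "\<And>x. x \<in> A \<Longrightarrow> small (B x)"
  shows "small (\<Union>x\<in>A. B x)"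
proof -
  have "B ` A \<prec> (UNIV :: 'u set)"
    using A unfolding small_def by (rule lesspoll_trans1[OF image_lepoll])
  then show ?thesis
    using U B unfolding universe_def by blast
qed

lemma small_Un:
  fixes A B :: "'u set"
  assumes U: "universe TYPE('u)" and "small A" "small B"
  shows "small (A \<union> B)"
proof -
  have "{A, B} \<prec> (UNIV :: 'u set)"
    by (rule finite_lesspoll_infinite[OF infinite_UNIV_universe[OF U]]) simp
  then have "small (\<Union>{A, B})"
    using U assms(2,3) unfolding universe_def by blast
  then show ?thesis by simp
qed

lemma small_tag:
  fixes A B :: "'u set"
  assumes U: "universe TYPE('u)" and "small A" "small B"
  shows "small (tag ` (A <+> B))"
proof -
  have "tag ` (A <+> B) = (\<lambda>x. tag (Inl x)) ` A \<union> (\<lambda>x. tag (Inr x)) ` B"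
    by auto
  then show ?thesis
    using small_Un[OF U small_image small_image] assms(2,3) by simp
qed

lemma small_pair:
  fixes A B :: "'u set"
  assumes U: "universe TYPE('u)" and "small A" "small B"
  shows "small (pair ` (A \<times> B))"
proof -
  have "pair ` (A \<times> B) = (\<Union>x\<in>A. (\<lambda>y. pair (x, y)) ` B)"
    by auto
  then show ?thesis
    using small_UN[OF U assms(2) small_image[OF assms(3)]] by simp
qed

text \<open>Either \<open>code S\<close> is chosen with a small image, or its fallback sends
  everything to \<open>pt\<close>. Smallness of \<open>TNat\<close> and \<open>TMu\<close> types
  thus follows without counting natural transformations or equivalence classes.\<close>

lemma small_code:
  assumes U: "universe TYPE('u)"
  shows "small ((code S :: 'b \<Rightarrow> 'u) ` S)"
proof (cases "\<exists>f :: 'b \<Rightarrow> 'u. inj_on f S \<and> small (f ` S)")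
  case True
  then have "inj_on (code S :: 'b \<Rightarrow> 'u) S \<and> small ((code S :: 'b \<Rightarrow> 'u) ` S)"
    using someI_ex[OF True] unfolding code_def by simp
  then show ?thesis ..
next
  case False
  then have "(code S :: 'b \<Rightarrow> 'u) ` S \<subseteq> {pt}"
    unfolding code_def by auto
  then have "finite ((code S :: 'b \<Rightarrow> 'u) ` S)"
    by (rule finite_subset) simp
  then show ?thesis
    by (rule small_finite[OF U])
qed

text \<open>An infinite type is equipollent to its square, so the choice that defines
  \<open>pair\<close> ranges over a nonempty set.\<close>

lemma inj_pair:
  assumes "universe TYPE('u)"
  shows "inj (pair :: 'u \<times> 'u \<Rightarrow> 'u)"
proof -
  obtain f :: "'u \<times> 'u \<Rightarrow> 'u" where "bij_betw f (UNIV \<times> UNIV) UNIV"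
    using card_of_Times_same_infinite[OF infinite_UNIV_universe[OF assms]] card_of_ordIso by blast
  then have "\<exists>f :: 'u \<times> 'u \<Rightarrow> 'u. inj f"
    by (auto simp: bij_betw_def)
  then show ?thesis
    unfolding pair_def by (rule someI_ex)
qed

section \<open>Equality relations\<close>

lemma tr1_Eq_fun [simp]: "tr1 (Eq_fun F) = F"
  and tr2_Eq_fun [simp]: "tr2 (Eq_fun F) = F"
  by (simp_all add: Eq_fun_def graph_rtrans_def)

lemma env1_Eq_env [simp]: "env1 (Eq_env \<rho>) = \<rho>"
  and env2_Eq_env [simp]: "env2 (Eq_env \<rho>) = \<rho>"
  by (simp_all add: env1_def env2_def Eq_env_def)

lemma Eq_set_sel [simp]: "rdom (Eq_set A) = A" "rcod (Eq_set A) = A" "graph (Eq_set A) = Id_on A"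
  by (simp_all add: Eq_set_def)

lemma map_rdom_Eq_set [simp]: "map rdom (map Eq_set As) = As"
  and map_rcod_Eq_set [simp]: "map rcod (map Eq_set As) = As"
  by (simp_all add: comp_def)

lemma RelObj_Eq_set: "As \<in> Obj k \<Longrightarrow> map Eq_set As \<in> RelObj k"
  by (auto simp: Obj_def RelObj_def)

text \<open>Both projections from a tabulated diagonal coincide, so the image defining
  \<open>star\<close> contains only pairs \<open>(y, y)\<close>. The projections have a right
  inverse, which \<open>F\<close> preserves; hence every \<open>y\<close> in
  \<open>fobj F As\<close> occurs.\<close>

lemma star_Eq_fun_Eq_set:
  fixes F :: "'u setfun"
  assumes U: "universe TYPE('u)" and F: "is_functor k F" and As: "As \<in> Obj k"
  shows "star (Eq_fun F) (map Eq_set As) = Eq_set (fobj F As)"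
proof -
  define Ts where "Ts = map (\<lambda>A. tabulate (Eq_set A)) As"
  define ps where "ps = map (\<lambda>A. proj1 (Eq_set A)) As"
  \<comment> \<open>The diagonal maps from \<open>A\<close> into the tabulated diagonal, right
    inverse to the projections \<open>ps\<close>.\<close>
  define ds where "ds = map (\<lambda>A. \<lambda>x\<in>A. pair (x, x)) As"
  have inv_pair: "inv pair (pair p) = p" for p :: "'u \<times> 'u"
    by (rule inv_f_f[OF inj_pair[OF U]])
  have tab: "tabulate (Eq_set A) = (\<lambda>x. pair (x, x)) ` A" for A :: "'u set"
    by (auto simp: tabulate_def)
  have proj12: "proj2 (Eq_set A) = proj1 (Eq_set A)" for A :: "'u set"
    by (auto simp: proj1_def proj2_def tab inv_pair fun_eq_iff)
  have Ts: "Ts \<in> Obj k"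
    using As by (auto simp: Obj_def Ts_def tab intro: small_image)
  have ps: "ps \<in> Hom Ts As" and ds: "ds \<in> Hom As Ts"
    by (auto simp: Hom_def ps_def Ts_def ds_def proj1_def tab inv_pair)
  have "comps As ps ds = map ident As"
    by (rule nth_equalityI)
      (auto simp: comps_def ps_def ds_def ident_def compose_def proj1_def tab inv_pair fun_eq_iff)
  then have comp: "compose (fobj F As) (fmap F Ts As ps) (fmap F As Ts ds) = ident (fobj F As)"
    using F As Ts ps ds unfolding is_functor_def by (metis (lifting))
  then have section_ps: "fmap F Ts As ps (fmap F As Ts ds x) = x" if "x \<in> fobj F As" for x
  proof -
    have "fmap F Ts As ps (fmap F As Ts ds x) = ident (fobj F As) x"
      unfolding comp[symmetric] by (simp add: compose_eq[OF that])
    with that show ?thesis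
      by (simp add: ident_def)
  qed
  have fmap_ps: "fmap F Ts As ps \<in> fobj F Ts \<rightarrow> fobj F As"
    and fmap_ds: "fmap F As Ts ds \<in> fobj F As \<rightarrow> fobj F Ts"
    using F As Ts ps ds unfolding is_functor_def PiE_def by blast+
  \<comment> \<open>The image from \<open>graph_rtrans\<close>, with \<open>proj2\<close> replaced
    by \<open>proj1\<close>; the factor \<open>ident\<close> is the component of
    \<open>id_nt F\<close>.\<close>
  have "(\<lambda>z. (fmap F Ts As ps z, ident (fobj F As) (fmap F Ts As ps z))) ` fobj F Ts
      = (\<lambda>x. (x, x)) ` fmap F Ts As ps ` fobj F Ts"
    unfolding image_image by (rule image_cong) (use fmap_ps in \<open>auto simp: ident_def\<close>)
  also have "fmap F Ts As ps ` fobj F Ts = fobj F As"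
    using fmap_ps fmap_ds section_ps by (force simp: image_iff)
  also have "(\<lambda>x. (x, x)) ` fobj F As = Id_on (fobj F As)"
    by auto
  finally show ?thesis
    by (simp add: Eq_fun_def graph_rtrans_def id_nt_def Let_def Eq_set_def[of "fobj F As"] comp_def
        proj12 flip: Ts_def ps_def)
qed

section \<open>Environments\<close>

lemma map_of_zip_map: "the (map_of (zip xs (map f ys)) x) = f (the (map_of (zip xs ys) x))"
  if "x \<in> set xs" "length xs = length ys"
  using that(2,1) by (induction xs ys rule: list_induct2) auto

lemma map_of_zip_in_set: "the (map_of (zip xs ys) x) \<in> set ys"
  if "x \<in> set xs" "length xs = length ys"
  using that(2,1) by (induction xs ys rule: list_induct2) auto

lemma env1_ext_rel:
  "length Rs = length \<alpha>s \<Longrightarrow> env1 (ext_rel \<sigma> \<alpha>s Rs) = ext_set (env1 \<sigma>) \<alpha>s (map rdom Rs)"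
  by (auto simp: fun_eq_iff env1_def ext_rel_def ext_set_def upds_def map_of_zip_map cst_rel_def)

lemma env2_ext_rel:
  "length Rs = length \<alpha>s \<Longrightarrow> env2 (ext_rel \<sigma> \<alpha>s Rs) = ext_set (env2 \<sigma>) \<alpha>s (map rcod Rs)"
  by (auto simp: fun_eq_iff env2_def ext_rel_def ext_set_def upds_def map_of_zip_map cst_rel_def)

section \<open>Dependence on the free variables\<close>

text \<open>\<open>V\<close> stands for a context containing the free variables. The three
  components are bundled because the interpretations are mutually recursive. The purpose is the
  \<open>TNat\<close> case, where a relation environment is exchanged for an equality environment
  that agrees with it on \<Gamma> only.\<close>

definition sem_cong :: "tyvar set \<Rightarrow> 'u sem_obj \<Rightarrow> 'u sem_mor \<Rightarrow> 'u sem_rel \<Rightarrow> bool" where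
  "sem_cong V h m r \<longleftrightarrow>
     (\<forall>\<rho>1 \<rho>2. (\<forall>v\<in>V. \<rho>1 v = \<rho>2 v) \<longrightarrow> h \<rho>1 = h \<rho>2) \<and>
     (\<forall>\<rho>1 \<rho>2 \<rho>1' \<rho>2' f1 f2. (\<forall>v\<in>V. \<rho>1 v = \<rho>2 v \<and> \<rho>1' v = \<rho>2' v \<and> f1 v = f2 v) \<longrightarrow>
        m \<rho>1 \<rho>1' f1 = m \<rho>2 \<rho>2' f2) \<and>
     (\<forall>\<sigma>1 \<sigma>2. (\<forall>v\<in>V. \<sigma>1 v = \<sigma>2 v) \<longrightarrow> r \<sigma>1 = r \<sigma>2)"

lemma sem_congI:
  assumes "\<And>\<rho>1 \<rho>2. \<forall>v\<in>V. \<rho>1 v = \<rho>2 v \<Longrightarrow> h \<rho>1 = h \<rho>2"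
    and "\<And>\<rho>1 \<rho>2 \<rho>1' \<rho>2' f1 f2. \<forall>v\<in>V. \<rho>1 v = \<rho>2 v \<Longrightarrow> \<forall>v\<in>V. \<rho>1' v = \<rho>2' v \<Longrightarrow>
      \<forall>v\<in>V. f1 v = f2 v \<Longrightarrow> m \<rho>1 \<rho>1' f1 = m \<rho>2 \<rho>2' f2"
    and "\<And>\<sigma>1 \<sigma>2. \<forall>v\<in>V. \<sigma>1 v = \<sigma>2 v \<Longrightarrow> r \<sigma>1 = r \<sigma>2"
  shows "sem_cong V h m r"
  unfolding sem_cong_def
  by (intro conjI allI impI; rule assms) simp_all

lemma
  assumes "sem_cong V h m r"
  shows sem_cong_obj: "\<forall>v\<in>V. \<rho>1 v = \<rho>2 v \<Longrightarrow> h \<rho>1 = h \<rho>2"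
    and sem_cong_mor: "\<forall>v\<in>V. \<rho>1 v = \<rho>2 v \<Longrightarrow> \<forall>v\<in>V. \<rho>1' v = \<rho>2' v \<Longrightarrow> \<forall>v\<in>V. f1 v = f2 v \<Longrightarrow>
      m \<rho>1 \<rho>1' f1 = m \<rho>2 \<rho>2' f2"
    and sem_cong_rel: "\<forall>v\<in>V. \<sigma>1 v = \<sigma>2 v \<Longrightarrow> r \<sigma>1 = r \<sigma>2"
proof -
  note sem_cong = assms[unfolded sem_cong_def]
  show "\<forall>v\<in>V. \<rho>1 v = \<rho>2 v \<Longrightarrow> h \<rho>1 = h \<rho>2"
    by (rule sem_cong[THEN conjunct1, rule_format]) simp
  show "\<forall>v\<in>V. \<rho>1 v = \<rho>2 v \<Longrightarrow> \<forall>v\<in>V. \<rho>1' v = \<rho>2' v \<Longrightarrow> \<forall>v\<in>V. f1 v = f2 v \<Longrightarrow>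
      m \<rho>1 \<rho>1' f1 = m \<rho>2 \<rho>2' f2"
    by (rule sem_cong[THEN conjunct2, THEN conjunct1, rule_format]) simp
  show "\<forall>v\<in>V. \<sigma>1 v = \<sigma>2 v \<Longrightarrow> r \<sigma>1 = r \<sigma>2"
    by (rule sem_cong[THEN conjunct2, THEN conjunct2, rule_format]) simp
qed

text \<open>Both extensions give the variables in \<alpha>s the same values, and
  \<open>id_env\<close> depends on the environment pointwise, so agreement on \<Gamma> is
  enough.\<close>

lemma lam_cong:
  assumes "sem_cong (\<Gamma> \<union> set \<alpha>s) h m r" and "\<forall>v\<in>\<Gamma>. \<rho>1 v = \<rho>2 v"
  shows "lam \<alpha>s h m \<rho>1 = lam \<alpha>s h m \<rho>2"
proof -
  have set: "\<forall>v\<in>\<Gamma> \<union> set \<alpha>s. ext_set \<rho>1 \<alpha>s As v = ext_set \<rho>2 \<alpha>s As v" for As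
    using assms(2) by (auto simp: ext_set_def upds_def)
  have mor: "\<forall>v\<in>\<Gamma> \<union> set \<alpha>s. ext_mor (id_env \<rho>1) \<alpha>s fs v = ext_mor (id_env \<rho>2) \<alpha>s fs v" for fs
    using assms(2) by (auto simp: ext_mor_def upds_def id_env_def)
  show ?thesis
    by (simp add: lam_def sem_cong_obj[OF assms(1) set] sem_cong_mor[OF assms(1) set set mor])
qed

lemma Nat_preserving_cong:
  assumes "sem_cong (\<Gamma> \<union> set \<alpha>s) h m r" "sem_cong (\<Gamma> \<union> set \<alpha>s) h' m' r'"
    and "\<forall>v\<in>\<Gamma>. \<sigma>1 v = \<sigma>2 v"
  shows "Nat_preserving \<alpha>s r r' \<sigma>1 t t' \<longleftrightarrow> Nat_preserving \<alpha>s r r' \<sigma>2 t t'"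
proof -
  have "\<forall>v\<in>\<Gamma> \<union> set \<alpha>s. ext_rel \<sigma>1 \<alpha>s Rs v = ext_rel \<sigma>2 \<alpha>s Rs v" for Rs
    using assms(3) by (auto simp: ext_rel_def upds_def)
  from sem_cong_rel[OF assms(1) this] sem_cong_rel[OF assms(2) this] show ?thesis
    unfolding Nat_preserving_def by simp
qed

text \<open>The relational condition is taken at \<open>Eq_env\<close>, which is also built
  pointwise, so agreement of set environments on \<Gamma> carries over to it.\<close>

lemma Nat_family_cong:
  assumes "sem_cong (\<Gamma> \<union> set \<alpha>s) h m r" "sem_cong (\<Gamma> \<union> set \<alpha>s) h' m' r'"
    and "\<forall>v\<in>\<Gamma>. \<rho>1 v = \<rho>2 v"
  shows "Nat_family \<alpha>s h m r h' m' r' \<rho>1 = Nat_family \<alpha>s h m r h' m' r' \<rho>2"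
proof -
  have "\<forall>v\<in>\<Gamma>. Eq_env \<rho>1 v = Eq_env \<rho>2 v"
    using assms(3) by (simp add: Eq_env_def)
  from Nat_preserving_cong[OF assms(1,2) this] show ?thesis
    unfolding Nat_family_def by (simp add: lam_cong[OF assms(1,3)] lam_cong[OF assms(2,3)])
qed

lemma Nat_rel_cong:
  assumes "sem_cong (\<Gamma> \<union> set \<alpha>s) h m r" "sem_cong (\<Gamma> \<union> set \<alpha>s) h' m' r'"
    and "\<forall>v\<in>\<Gamma>. \<sigma>1 v = \<sigma>2 v"
  shows "Nat_rel \<alpha>s h m r h' m' r' \<sigma>1 = Nat_rel \<alpha>s h m r h' m' r' \<sigma>2"
proof -
  have "\<forall>v\<in>\<Gamma>. env1 \<sigma>1 v = env1 \<sigma>2 v" "\<forall>v\<in>\<Gamma>. env2 \<sigma>1 v = env2 \<sigma>2 v"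
    using assms(3) by (simp_all add: env1_def env2_def)
  from this[THEN Nat_family_cong[OF assms(1,2)]] show ?thesis
    unfolding Nat_rel_def by (simp add: Nat_preserving_cong[OF assms])
qed

section \<open>Congruence of the fixpoint constructions\<close>

context
  fixes \<Gamma> :: "tyvar set" and \<phi> :: tyvar and \<alpha>s :: "tyvar list"
    and h :: "'u sem_obj" and m :: "'u sem_mor" and r :: "'u sem_rel"
  assumes cong: "sem_cong (\<Gamma> \<union> insert \<phi> (set \<alpha>s)) h m r"
begin

lemma T_obj_cong:
  assumes "\<forall>v\<in>\<Gamma>. \<rho>1 v = \<rho>2 v"
  shows "T_obj \<phi> \<alpha>s h m \<rho>1 = T_obj \<phi> \<alpha>s h m \<rho>2"
proof
  fix F
  \<comment> \<open>Regrouped so that \<phi> counts as a free variable of the context: after the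
    update at \<phi> both environments agree there too.\<close>
  have "sem_cong (insert \<phi> \<Gamma> \<union> set \<alpha>s) h m r"
    using cong by simp
  then show "T_obj \<phi> \<alpha>s h m \<rho>1 F = T_obj \<phi> \<alpha>s h m \<rho>2 F"
    unfolding T_obj_def by (rule lam_cong) (use assms in auto)
qed

lemma T_map_cong:
  assumes "\<forall>v\<in>\<Gamma>. \<rho>1 v = \<rho>2 v" "\<forall>v\<in>\<Gamma>. \<rho>1' v = \<rho>2' v" "\<forall>v\<in>\<Gamma>. f1 v = f2 v"
  shows "T_map \<phi> \<alpha>s m \<rho>1 \<rho>1' f1 F F' \<nu> = T_map \<phi> \<alpha>s m \<rho>2 \<rho>2' f2 F F' \<nu>"
  unfolding T_map_def ext_set_def ext_mor_def
  by (rule ext, rule sem_cong_mor[OF cong]) (use assms in \<open>auto simp: upds_def\<close>)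

lemma T_iter_cong:
  assumes "\<forall>v\<in>\<Gamma>. \<rho>1 v = \<rho>2 v"
  shows "T_iter \<phi> \<alpha>s h m \<rho>1 = T_iter \<phi> \<alpha>s h m \<rho>2"
  by (simp add: fun_eq_iff T_iter_def T_obj_cong[OF assms])

lemma T_link_cong:
  assumes "\<forall>v\<in>\<Gamma>. \<rho>1 v = \<rho>2 v"
  shows "T_link \<phi> \<alpha>s h m \<rho>1 = T_link \<phi> \<alpha>s h m \<rho>2"
proof
  have "\<forall>v\<in>\<Gamma>. id_env \<rho>1 v = id_env \<rho>2 v"
    using assms by (simp add: id_env_def)
  note T_map_cong[OF assms assms this]
  then show "T_link \<phi> \<alpha>s h m \<rho>1 n = T_link \<phi> \<alpha>s h m \<rho>2 n" for n
    by (induction n) (simp_all add: T_iter_cong[OF assms])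
qed

lemma T_env_cong:
  assumes "\<forall>v\<in>\<Gamma>. \<rho>1 v = \<rho>2 v" "\<forall>v\<in>\<Gamma>. \<rho>1' v = \<rho>2' v" "\<forall>v\<in>\<Gamma>. f1 v = f2 v"
  shows "T_env \<phi> \<alpha>s h m \<rho>1 \<rho>1' f1 = T_env \<phi> \<alpha>s h m \<rho>2 \<rho>2' f2"
proof
  show "T_env \<phi> \<alpha>s h m \<rho>1 \<rho>1' f1 n = T_env \<phi> \<alpha>s h m \<rho>2 \<rho>2' f2 n" for n
    by (induction n)
      (simp_all add: T_map_cong[OF assms] T_iter_cong[OF assms(1)] T_iter_cong[OF assms(2)])
qed

lemma Mu_fun_cong:
  assumes "\<forall>v\<in>\<Gamma>. \<rho>1 v = \<rho>2 v"
  shows "Mu_fun \<phi> \<alpha>s h m \<rho>1 = Mu_fun \<phi> \<alpha>s h m \<rho>2"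
  unfolding Mu_fun_def by (simp add: T_iter_cong[OF assms] T_link_cong[OF assms])

lemma Mu_env_cong:
  assumes "\<forall>v\<in>\<Gamma>. \<rho>1 v = \<rho>2 v" "\<forall>v\<in>\<Gamma>. \<rho>1' v = \<rho>2' v" "\<forall>v\<in>\<Gamma>. f1 v = f2 v"
  shows "Mu_env \<phi> \<alpha>s h m \<rho>1 \<rho>1' f1 = Mu_env \<phi> \<alpha>s h m \<rho>2 \<rho>2' f2"
  unfolding Mu_env_def
  by (simp add: T_iter_cong[OF assms(1)] T_link_cong[OF assms(1)]
      T_iter_cong[OF assms(2)] T_link_cong[OF assms(2)] T_env_cong[OF assms])

lemma Mu_rel_cong:
  assumes "\<forall>v\<in>\<Gamma>. \<sigma>1 v = \<sigma>2 v"
  shows "Mu_rel \<phi> \<alpha>s h m r \<sigma>1 = Mu_rel \<phi> \<alpha>s h m r \<sigma>2"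
proof -
  have env: "\<forall>v\<in>\<Gamma>. env1 \<sigma>1 v = env1 \<sigma>2 v" "\<forall>v\<in>\<Gamma>. env2 \<sigma>1 v = env2 \<sigma>2 v"
    using assms by (simp_all add: env1_def env2_def)
  have "r (ext_rel (\<sigma>1(\<phi> := F)) \<alpha>s Rs) = r (ext_rel (\<sigma>2(\<phi> := F)) \<alpha>s Rs)" for F Rs
    by (rule sem_cong_rel[OF cong]) (use assms in \<open>auto simp: ext_rel_def upds_def\<close>)
  then have "T_rel \<phi> \<alpha>s h m r \<sigma>1 = T_rel \<phi> \<alpha>s h m r \<sigma>2"
    unfolding T_rel_def fun_eq_iff by (simp add: T_obj_cong[OF env(1)] T_obj_cong[OF env(2)])
  then show ?thesis
    unfolding Mu_rel_def Mu_in_def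
    by (simp add: env[THEN T_iter_cong] env[THEN T_link_cong] env[THEN Mu_fun_cong])
qed

end

text \<open>The bodies of \<open>TNat\<close> and \<open>TMu\<close> are typed over \<Gamma> and
  their bound variables, and the latter receive equal values on both sides. Agreement on \<Phi>
  enters through applied variables and through the arguments of a fixpoint.\<close>

lemma sem_cong_type: "\<Gamma>; \<Phi> \<turnstile> F \<Longrightarrow> sem_cong (\<Gamma> \<union> \<Phi>) (set_sem F :: 'u sem_obj) (set_mor F) (rel_sem F)"
proof (induction rule: wf_type.induct)
  case (wf_Zero \<Gamma> \<Phi>)
  then show ?case by (simp add: sem_cong_def)
next
  case (wf_One \<Gamma> \<Phi>)
  then show ?case by (simp add: sem_cong_def)
next
  case (wf_Nat \<alpha>s \<Gamma> F G \<Phi>)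
  have set: "set_sem (TNat \<alpha>s F G) \<rho>1 = set_sem (TNat \<alpha>s F G) \<rho>2"
    if "\<forall>v\<in>\<Gamma> \<union> \<Phi>. \<rho>1 v = \<rho>2 v" for \<rho>1 \<rho>2 :: "'u setenv"
  proof -
    from that have "\<forall>v\<in>\<Gamma>. \<rho>1 v = \<rho>2 v" by simp
    from Nat_family_cong[OF wf_Nat.IH this] show ?thesis
      by (simp add: Nat_set_def)
  qed
  show ?case
  proof (rule sem_congI, goal_cases)
    case (1 \<rho>1 \<rho>2)
    then show ?case by (rule set)
  next
    case (2 \<rho>1 \<rho>2 \<rho>1' \<rho>2' f1 f2)
    \<comment> \<open>\<open>set_mor\<close> of a \<open>TNat\<close> type is the identity on its
      set interpretation.\<close>
    from set[OF 2(1)] show ?case by simp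
  next
    case (3 \<sigma>1 \<sigma>2)
    then have "\<forall>v\<in>\<Gamma>. \<sigma>1 v = \<sigma>2 v" by simp
    from Nat_rel_cong[OF wf_Nat.IH this] show ?case by simp
  qed
next
  case (wf_App \<phi> \<Gamma> \<Phi> Fs)
  then have IH: "sem_cong (\<Gamma> \<union> \<Phi>) (set_sem F :: 'u sem_obj) (set_mor F) (rel_sem F)"
    if "F \<in> set Fs" for F
    using that by blast
  show ?case
  proof (rule sem_congI, goal_cases)
    case (1 \<rho>1 \<rho>2)
    then have "map (\<lambda>F. set_sem F \<rho>1) Fs = map (\<lambda>F. set_sem F \<rho>2) Fs"
      using sem_cong_obj[OF IH] by simp
    moreover have "\<rho>1 \<phi> = \<rho>2 \<phi>"
      using 1 wf_App(1) by blast
    ultimately show ?case by (simp del: map_eq_conv)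
  next
    case (2 \<rho>1 \<rho>2 \<rho>1' \<rho>2' f1 f2)
    have "map (\<lambda>F. set_sem F \<rho>1) Fs = map (\<lambda>F. set_sem F \<rho>2) Fs"
      "map (\<lambda>F. set_sem F \<rho>1') Fs = map (\<lambda>F. set_sem F \<rho>2') Fs"
      using 2 sem_cong_obj[OF IH] by simp_all
    moreover have "map (\<lambda>F. set_mor F \<rho>1 \<rho>1' f1) Fs = map (\<lambda>F. set_mor F \<rho>2 \<rho>2' f2) Fs"
      using sem_cong_mor[OF IH 2] by simp
    moreover have "\<rho>1 \<phi> = \<rho>2 \<phi>" "f1 \<phi> = f2 \<phi>"
      using 2 wf_App(1) by blast+
    ultimately show ?case by (simp del: map_eq_conv)
  next
    case (3 \<sigma>1 \<sigma>2)
    then have "map (\<lambda>F. rel_sem F \<sigma>1) Fs = map (\<lambda>F. rel_sem F \<sigma>2) Fs"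
      using sem_cong_rel[OF IH] by simp
    moreover have "\<sigma>1 \<phi> = \<sigma>2 \<phi>"
      using 3 wf_App(1) by blast
    ultimately show ?case by (simp del: map_eq_conv)
  qed
next
  case (wf_Mu \<alpha>s \<phi> \<Gamma> H Gs \<Phi>)
  then have IH: "sem_cong (\<Gamma> \<union> \<Phi>) (set_sem G :: 'u sem_obj) (set_mor G) (rel_sem G)"
    if "G \<in> set Gs" for G
    using that by blast
  show ?case
  proof (rule sem_congI, goal_cases)
    case (1 \<rho>1 \<rho>2)
    then have "map (\<lambda>F. set_sem F \<rho>1) Gs = map (\<lambda>F. set_sem F \<rho>2) Gs"
      using sem_cong_obj[OF IH] by simp
    moreover have "\<forall>v\<in>\<Gamma>. \<rho>1 v = \<rho>2 v"
      using 1 by blast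
    note Mu_fun_cong[OF wf_Mu.IH(1) this]
    ultimately show ?case by (simp del: map_eq_conv)
  next
    case (2 \<rho>1 \<rho>2 \<rho>1' \<rho>2' f1 f2)
    have "map (\<lambda>F. set_sem F \<rho>1) Gs = map (\<lambda>F. set_sem F \<rho>2) Gs"
      "map (\<lambda>F. set_sem F \<rho>1') Gs = map (\<lambda>F. set_sem F \<rho>2') Gs"
      using 2 sem_cong_obj[OF IH] by simp_all
    moreover have "map (\<lambda>F. set_mor F \<rho>1 \<rho>1' f1) Gs = map (\<lambda>F. set_mor F \<rho>2 \<rho>2' f2) Gs"
      using sem_cong_mor[OF IH 2] by simp
    moreover have "\<forall>v\<in>\<Gamma>. \<rho>1 v = \<rho>2 v" "\<forall>v\<in>\<Gamma>. \<rho>1' v = \<rho>2' v" "\<forall>v\<in>\<Gamma>. f1 v = f2 v"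
      using 2 by blast+
    note Mu_fun_cong[OF wf_Mu.IH(1) this(1)] Mu_env_cong[OF wf_Mu.IH(1) this]
    ultimately show ?case by (simp del: map_eq_conv)
  next
    case (3 \<sigma>1 \<sigma>2)
    then have "map (\<lambda>F. rel_sem F \<sigma>1) Gs = map (\<lambda>F. rel_sem F \<sigma>2) Gs"
      using sem_cong_rel[OF IH] by simp
    moreover have "\<forall>v\<in>\<Gamma>. \<sigma>1 v = \<sigma>2 v"
      using 3 by blast
    note Mu_rel_cong[OF wf_Mu.IH(1) this]
    ultimately show ?case by (simp del: map_eq_conv)
  qed
next
  case (wf_Sum \<Gamma> \<Phi> F G)
  show ?case
  proof (rule sem_congI, goal_cases)
    case (1 \<rho>1 \<rho>2)
    then show ?case using wf_Sum.IH[THEN sem_cong_obj, OF 1] by simp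
  next
    case (2 \<rho>1 \<rho>2 \<rho>1' \<rho>2' f1 f2)
    then show ?case
      using wf_Sum.IH[THEN sem_cong_obj, OF 2(1)] wf_Sum.IH[THEN sem_cong_mor, OF 2] by simp
  next
    case (3 \<sigma>1 \<sigma>2)
    then show ?case using wf_Sum.IH[THEN sem_cong_rel, OF 3] by simp
  qed
next
  case (wf_Prod \<Gamma> \<Phi> F G)
  show ?case
  proof (rule sem_congI, goal_cases)
    case (1 \<rho>1 \<rho>2)
    then show ?case using wf_Prod.IH[THEN sem_cong_obj, OF 1] by simp
  next
    case (2 \<rho>1 \<rho>2 \<rho>1' \<rho>2' f1 f2)
    then show ?case
      using wf_Prod.IH[THEN sem_cong_obj, OF 2(1)] wf_Prod.IH[THEN sem_cong_mor, OF 2] by simp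
  next
    case (3 \<sigma>1 \<sigma>2)
    then show ?case using wf_Prod.IH[THEN sem_cong_rel, OF 3] by simp
  qed
qed

section \<open>Environments that act as equality on equality relations\<close>

text \<open>\<open>S\<close> is compared with \<open>Eq_fun F\<close> only at tuples of equality
  relations. Smallness of the values takes the place of functoriality of \<open>F\<close>, so the
  iterates \<open>T_iter\<close> need not be shown to be functors.\<close>

definition eq_on_eq :: "nat \<Rightarrow> 'u setfun \<Rightarrow> 'u rtrans \<Rightarrow> bool" where
  "eq_on_eq k F S \<longleftrightarrow> tr1 S = F \<and> tr2 S = F \<and>
     (\<forall>As\<in>Obj k. small (fobj F As) \<and> star S (map Eq_set As) = Eq_set (fobj F As))"

text \<open>The exact equation on \<Gamma> lets \<open>sem_cong\<close> replace \<sigma> by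
  \<open>Eq_env \<rho>\<close> under \<open>TNat\<close>. The projections must agree with \<rho> as
  whole environments because \<open>Nat_rel\<close> and \<open>Mu_rel\<close> are built from
  \<open>env1 \<sigma>\<close> and \<open>env2 \<sigma>\<close>.\<close>

definition Eq_like :: "tyvar set \<Rightarrow> tyvar set \<Rightarrow> 'u setenv \<Rightarrow> 'u relenv \<Rightarrow> bool" where
  "Eq_like \<Gamma> \<Phi> \<rho> \<sigma> \<longleftrightarrow> env1 \<sigma> = \<rho> \<and> env2 \<sigma> = \<rho> \<and> (\<forall>v\<in>\<Gamma>. \<sigma> v = Eq_fun (\<rho> v)) \<and>
     (\<forall>v\<in>\<Gamma> \<union> \<Phi>. eq_on_eq (arity v) (\<rho> v) (\<sigma> v))"

lemma eq_on_eq_cst: "small A \<Longrightarrow> eq_on_eq 0 (cst A) (cst_rel (Eq_set A))"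
  by (simp add: eq_on_eq_def cst_rel_def cst_def)

lemma eq_on_eq_Eq_fun:
  "universe TYPE('u) \<Longrightarrow> is_functor k F \<Longrightarrow> eq_on_eq k F (Eq_fun F)" for F :: "'u setfun"
  by (simp add: eq_on_eq_def star_Eq_fun_Eq_set) (simp add: is_functor_def)

text \<open>The variables in \<alpha>s are functorial and hence outside \<Gamma>, so the exact
  equation on \<Gamma> survives. The new values are constants at \<open>A\<close> and at
  \<open>Eq_set A\<close>.\<close>

lemma Eq_like_ext:
  assumes "Eq_like \<Gamma> \<Phi> \<rho> \<sigma>" and \<Gamma>: "\<Gamma> \<subseteq> TCVars" and \<alpha>s: "fvars0 \<alpha>s"
    and As: "As \<in> Obj (length \<alpha>s)"
  shows "Eq_like \<Gamma> (\<Phi> \<union> set \<alpha>s) (ext_set \<rho> \<alpha>s As) (ext_rel \<sigma> \<alpha>s (map Eq_set As))"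
proof -
  have len: "length \<alpha>s = length As"
    using As by (simp add: Obj_def)
  have disj: "v \<notin> set \<alpha>s" if "v \<in> \<Gamma>" for v
    using that \<Gamma> \<alpha>s by (auto simp: fvars0_def TCVars_def FVars_def)
  have "eq_on_eq (arity v) (ext_set \<rho> \<alpha>s As v) (ext_rel \<sigma> \<alpha>s (map Eq_set As) v)"
    if "v \<in> set \<alpha>s" for v
  proof -
    let ?A = "the (map_of (zip \<alpha>s As) v)"
    have "small ?A"
      using As map_of_zip_in_set[OF that len] by (auto simp: Obj_def)
    moreover have "ext_set \<rho> \<alpha>s As v = cst ?A"
      "ext_rel \<sigma> \<alpha>s (map Eq_set As) v = cst_rel (Eq_set ?A)"
      using that len
      by (simp_all add: ext_set_def ext_rel_def upds_def map_of_zip_map del: map_map)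
    moreover have "arity v = 0"
      using \<alpha>s that by (simp add: fvars0_def)
    ultimately show ?thesis
      using eq_on_eq_cst by metis
  qed
  moreover have "ext_set \<rho> \<alpha>s As v = \<rho> v" "ext_rel \<sigma> \<alpha>s (map Eq_set As) v = \<sigma> v"
    if "v \<notin> set \<alpha>s" for v
    using that by (simp_all add: ext_set_def ext_rel_def upds_def)
  ultimately show ?thesis
    using assms(1) disj len unfolding Eq_like_def
    by (simp add: env1_ext_rel env2_ext_rel comp_def) (metis UnE UnI1 UnI2)
qed

text \<open>\<open>S\<close> may differ from \<open>Eq_fun F\<close>, so \<phi> has to lie outside
  the part where exact equality is demanded.\<close>

lemma Eq_like_upd:
  assumes "Eq_like \<Gamma> \<Phi> \<rho> \<sigma>" "eq_on_eq (arity \<phi>) F S" "\<phi> \<notin> \<Gamma>"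
  shows "Eq_like \<Gamma> (insert \<phi> \<Phi>) (\<rho>(\<phi> := F)) (\<sigma>(\<phi> := S))"
  using assms by (auto simp: Eq_like_def env1_def env2_def eq_on_eq_def fun_eq_iff)

lemma Eq_like_mono: "Eq_like \<Gamma> \<Phi> \<rho> \<sigma> \<Longrightarrow> \<Phi>' \<subseteq> \<Phi> \<Longrightarrow> Eq_like \<Gamma> \<Phi>' \<rho> \<sigma>"
  by (auto simp: Eq_like_def)

section \<open>The fixpoint case\<close>

lemma eq_on_eq_K0: "universe TYPE('u) \<Longrightarrow> eq_on_eq k (K0 :: 'u setfun) K0_rel"
  by (simp add: eq_on_eq_def K0_def K0_rel_def Eq_set_def small_finite)

text \<open>The assumption \<open>step\<close> is what the induction hypothesis for the body of a
  fixpoint supplies. It covers arbitrary \<open>F\<close> and \<open>S\<close> because \<phi> is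
  bound to a different pair of iterates at each stage.\<close>

lemma eq_on_eq_T_iter:
  fixes \<rho> :: "'u setenv"
  assumes U: "universe TYPE('u)" and env: "env1 \<sigma> = \<rho>" "env2 \<sigma> = \<rho>"
    and step: "\<And>F S As. eq_on_eq k F S \<Longrightarrow> As \<in> Obj k \<Longrightarrow>
      small (h (ext_set (\<rho>(\<phi> := F)) \<alpha>s As)) \<and>
      r (ext_rel (\<sigma>(\<phi> := S)) \<alpha>s (map Eq_set As)) = Eq_set (h (ext_set (\<rho>(\<phi> := F)) \<alpha>s As))"
  shows "eq_on_eq k (T_iter \<phi> \<alpha>s h m \<rho> n) ((T_rel \<phi> \<alpha>s h m r \<sigma> ^^ n) K0_rel)"
proof (induction n)
  case 0
  then show ?case by (simp add: T_iter_def eq_on_eq_K0[OF U])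
next
  case (Suc n)
  from Suc step[OF Suc] show ?case
    by (simp add: eq_on_eq_def T_iter_def T_rel_def T_obj_def lam_def env)
qed

text \<open>Every equivalence class has a representative \<open>(n, x)\<close> with \<open>x\<close>
  in \<open>A n\<close>; this does not depend on injectivity of \<open>code\<close>.\<close>

lemma colim_eq_UN_colim_in: "colim A f = (\<Union>n. colim_in A f n ` A n)"
  by (auto simp: colim_def colim_in_def colim_classes_def quotient_def image_iff)

text \<open>Applying one injection to both sides of a diagonal gives the diagonal of its image, and
  these images together exhaust the colimit.\<close>

lemma star_Mu_rel_Eq_set:
  assumes env: "env1 \<sigma> = \<rho>" "env2 \<sigma> = \<rho>"
    and iter: "\<And>n. eq_on_eq k (T_iter \<phi> \<alpha>s h m \<rho> n) ((T_rel \<phi> \<alpha>s h m r \<sigma> ^^ n) K0_rel)"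
    and As: "As \<in> Obj k"
  shows "star (Mu_rel \<phi> \<alpha>s h m r \<sigma>) (map Eq_set As) = Eq_set (fobj (Mu_fun \<phi> \<alpha>s h m \<rho>) As)"
proof -
  let ?in = "Mu_in \<phi> \<alpha>s h m \<rho> As"
  have "graph (star ((T_rel \<phi> \<alpha>s h m r \<sigma> ^^ n) K0_rel) (map Eq_set As))
      = Id_on (fobj (T_iter \<phi> \<alpha>s h m \<rho> n) As)" for n
    using iter[of n] As by (simp add: eq_on_eq_def)
  moreover have "(\<Union>n. map_prod (?in n) (?in n) ` Id_on (fobj (T_iter \<phi> \<alpha>s h m \<rho> n) As))
      = Id_on (\<Union>n. ?in n ` fobj (T_iter \<phi> \<alpha>s h m \<rho> n) As)"
    by (auto simp: image_iff)
  moreover have "(\<Union>n. ?in n ` fobj (T_iter \<phi> \<alpha>s h m \<rho> n) As) = fobj (Mu_fun \<phi> \<alpha>s h m \<rho>) As"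
    by (simp add: Mu_fun_def Mu_in_def colim_eq_UN_colim_in)
  ultimately show ?thesis
    by (simp add: Mu_rel_def env Eq_set_def[of "fobj _ _"] comp_def)
qed

section \<open>The identity extension lemma\<close>

text \<open>
  Transformations related at an equality environment have equal components, because the relations
  may be chosen to be equalities.  Equal transformations have equal codes, so it does not matter
  whether \<open>code\<close> is injective on the family.
\<close>

lemma Nat_rel_Eq_like:
  assumes env: "env1 \<sigma> = \<rho>" "env2 \<sigma> = \<rho>" and \<Gamma>: "\<forall>v\<in>\<Gamma>. \<sigma> v = Eq_fun (\<rho> v)"
    and cong: "sem_cong (\<Gamma> \<union> set \<alpha>s) h m r" "sem_cong (\<Gamma> \<union> set \<alpha>s) h' m' r'"
    and r: "\<And>As. As \<in> Obj (length \<alpha>s) \<Longrightarrow>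
      r (ext_rel \<sigma> \<alpha>s (map Eq_set As)) = Eq_set (h (ext_set \<rho> \<alpha>s As))"
    and r': "\<And>As. As \<in> Obj (length \<alpha>s) \<Longrightarrow>
      r' (ext_rel \<sigma> \<alpha>s (map Eq_set As)) = Eq_set (h' (ext_set \<rho> \<alpha>s As))"
  shows "Nat_rel \<alpha>s h m r h' m' r' \<sigma> = Eq_set (Nat_set \<alpha>s h m r h' m' r' \<rho>)"
proof -
  let ?N = "Nat_family \<alpha>s h m r h' m' r' \<rho>"
  have "t = t'" if t: "t \<in> ?N" "t' \<in> ?N" and P: "Nat_preserving \<alpha>s r r' \<sigma> t t'" for t t'
  proof (rule PiE_ext)
    show "t \<in> (\<Pi>\<^sub>E As\<in>Obj (length \<alpha>s). fobj (lam \<alpha>s h m \<rho>) As \<rightarrow>\<^sub>E fobj (lam \<alpha>s h' m' \<rho>) As)"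
      and t': "t' \<in> (\<Pi>\<^sub>E As\<in>Obj (length \<alpha>s). fobj (lam \<alpha>s h m \<rho>) As \<rightarrow>\<^sub>E fobj (lam \<alpha>s h' m' \<rho>) As)"
      using t by (simp_all add: Nat_family_def nat_trans_def)
    fix As :: "'a set list"
    assume As: "As \<in> Obj (length \<alpha>s)"
    have "preserves (t As) (t' As) (Eq_set (h (ext_set \<rho> \<alpha>s As))) (Eq_set (h' (ext_set \<rho> \<alpha>s As)))"
      using P RelObj_Eq_set[OF As] r[OF As] r'[OF As] unfolding Nat_preserving_def
      by (metis map_rdom_Eq_set map_rcod_Eq_set)
    then have "t As x = t' As x" if "x \<in> fobj (lam \<alpha>s h m \<rho>) As" for x
      using that by (auto simp: preserves_def lam_def dest!: bspec[where x = "(x, x)"])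
    moreover have "t As \<in> fobj (lam \<alpha>s h m \<rho>) As \<rightarrow>\<^sub>E fobj (lam \<alpha>s h' m' \<rho>) As"
      "t' As \<in> fobj (lam \<alpha>s h m \<rho>) As \<rightarrow>\<^sub>E fobj (lam \<alpha>s h' m' \<rho>) As"
      using t As unfolding Nat_family_def nat_trans_def by (auto simp del: PiE_iff)
    ultimately show "t As = t' As"
      by (meson PiE_ext)
  qed
  \<comment> \<open>Reflexivity: members of the family preserve relations at
    \<open>Eq_env \<rho>\<close>, and \<sigma> agrees with it on \<Gamma>, which together with
    \<alpha>s contains all free variables of both bodies.\<close>
  moreover have "Nat_preserving \<alpha>s r r' \<sigma> t t" if "t \<in> ?N" for t
  proof -
    have "\<forall>v\<in>\<Gamma>. \<sigma> v = Eq_env \<rho> v"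
      using \<Gamma> by (simp add: Eq_env_def)
    from Nat_preserving_cong[OF cong this] that show ?thesis
      by (simp add: Nat_family_def)
  qed
  ultimately have "{(code ?N t, code ?N t') | t t'. t \<in> ?N \<and> t' \<in> ?N \<and> Nat_preserving \<alpha>s r r' \<sigma> t t'}
      = Id_on (code ?N ` ?N)"
    by blast
  then show ?thesis
    by (simp add: Nat_rel_def Nat_set_def env Let_def Eq_set_def)
qed

text \<open>The identity extension property, generalized to \<open>Eq_like\<close> environments so
  that it applies under binders. Smallness is carried along because \<open>eq_on_eq\<close> speaks
  only of tuples of small sets, and arguments of variables and fixpoints must be such
  tuples.\<close>

lemma rel_sem_Eq_like:
  fixes \<rho> :: "'u setenv"
  assumes U: "universe TYPE('u)"
  shows "\<Gamma>; \<Phi> \<turnstile> F \<Longrightarrow> \<Gamma> \<subseteq> TCVars \<Longrightarrow> Eq_like \<Gamma> \<Phi> \<rho> \<sigma> \<Longrightarrow>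
    small (set_sem F \<rho>) \<and> rel_sem F \<sigma> = Eq_set (set_sem F \<rho>)"
proof (induction arbitrary: \<rho> \<sigma> rule: wf_type.induct)
  case (wf_Zero \<Gamma> \<Phi>)
  then show ?case by (simp add: Eq_set_def small_finite[OF U])
next
  case (wf_One \<Gamma> \<Phi>)
  then show ?case by (auto simp: Eq_set_def small_finite[OF U])
next
  case (wf_Nat \<alpha>s \<Gamma> F G \<Phi>)
  \<comment> \<open>The outer functorial variables \<Phi> are discarded, since the bodies are typed
    over \<Gamma> and \<alpha>s.\<close>
  have Eq_like_F_G: "Eq_like \<Gamma> (set \<alpha>s) (ext_set \<rho> \<alpha>s As) (ext_rel \<sigma> \<alpha>s (map Eq_set As))"
    if "As \<in> Obj (length \<alpha>s)" for As
    by (rule Eq_like_mono[OF Eq_like_ext[OF wf_Nat.prems(2,1) wf_Nat(1) that]]) simp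
  have "rel_sem (TNat \<alpha>s F G) \<sigma> = Eq_set (set_sem (TNat \<alpha>s F G) \<rho>)"
    unfolding set_sem.simps rel_sem.simps
  proof (rule Nat_rel_Eq_like)
    show "sem_cong (\<Gamma> \<union> set \<alpha>s) (set_sem F) (set_mor F) (rel_sem F)"
      by (rule sem_cong_type[OF wf_Nat(2)])
    show "sem_cong (\<Gamma> \<union> set \<alpha>s) (set_sem G) (set_mor G) (rel_sem G)"
      by (rule sem_cong_type[OF wf_Nat(3)])
  qed (use wf_Nat.prems wf_Nat.IH Eq_like_F_G in \<open>simp_all add: Eq_like_def\<close>)
  then show ?case
    by (simp add: Nat_set_def Let_def small_code[OF U])
next
  case (wf_App \<phi> \<Gamma> \<Phi> Fs)
  let ?As = "map (\<lambda>F. set_sem F \<rho>) Fs"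
  have "?As \<in> Obj (arity \<phi>)"
    using wf_App by (auto simp: Obj_def)
  moreover have "map (\<lambda>F. rel_sem F \<sigma>) Fs = map Eq_set ?As"
    using wf_App by simp
  moreover have "eq_on_eq (arity \<phi>) (\<rho> \<phi>) (\<sigma> \<phi>)"
    using wf_App(1,5) by (simp add: Eq_like_def)
  ultimately show ?case
    by (simp add: eq_on_eq_def del: map_map)
next
  case (wf_Mu \<alpha>s \<phi> \<Gamma> H Gs \<Phi>)
  let ?As = "map (\<lambda>G. set_sem G \<rho>) Gs"
  have env: "env1 \<sigma> = \<rho>" "env2 \<sigma> = \<rho>"
    using wf_Mu.prems by (simp_all add: Eq_like_def)
  have As: "?As \<in> Obj (arity \<phi>)"
    using wf_Mu by (auto simp: Obj_def)
  have "eq_on_eq (arity \<phi>) (T_iter \<phi> \<alpha>s (set_sem H) (set_mor H) \<rho> n)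
      ((T_rel \<phi> \<alpha>s (set_sem H) (set_mor H) (rel_sem H) \<sigma> ^^ n) K0_rel)" for n
  proof (rule eq_on_eq_T_iter[OF U env])
    fix F :: "'u setfun" and S and As :: "'u set list"
    assume FS: "eq_on_eq (arity \<phi>) F S" and As: "As \<in> Obj (arity \<phi>)"
    \<comment> \<open>\<phi> is functorial, whereas \<Gamma> consists of type constructor
      variables.\<close>
    have "\<phi> \<notin> \<Gamma>"
      using wf_Mu(2) wf_Mu.prems(1) by (auto simp: FVars_def TCVars_def)
    from Eq_like_upd[OF wf_Mu.prems(2) FS this]
    have "Eq_like \<Gamma> (insert \<phi> \<Phi> \<union> set \<alpha>s) (ext_set (\<rho>(\<phi> := F)) \<alpha>s As)
      (ext_rel (\<sigma>(\<phi> := S)) \<alpha>s (map Eq_set As))"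
      using wf_Mu.prems(1) wf_Mu(1) As wf_Mu(4) by (metis Eq_like_ext)
    then have "Eq_like \<Gamma> (insert \<phi> (set \<alpha>s)) (ext_set (\<rho>(\<phi> := F)) \<alpha>s As)
      (ext_rel (\<sigma>(\<phi> := S)) \<alpha>s (map Eq_set As))"
      by (rule Eq_like_mono) auto
    from wf_Mu.IH(1)[OF wf_Mu.prems(1) this]
    show "small (set_sem H (ext_set (\<rho>(\<phi> := F)) \<alpha>s As)) \<and>
      rel_sem H (ext_rel (\<sigma>(\<phi> := S)) \<alpha>s (map Eq_set As)) =
      Eq_set (set_sem H (ext_set (\<rho>(\<phi> := F)) \<alpha>s As))" .
  qed
  from star_Mu_rel_Eq_set[OF env this As]
  have "rel_sem (TMu \<phi> \<alpha>s H Gs) \<sigma> = Eq_set (set_sem (TMu \<phi> \<alpha>s H Gs) \<rho>)"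
    using wf_Mu by (simp add: comp_def cong: map_cong)
  then show ?case
    by (simp add: Mu_fun_def colim_def small_code[OF U])
next
  case (wf_Sum \<Gamma> \<Phi> F G)
  then have "rel_sem F \<sigma> = Eq_set (set_sem F \<rho>)" "rel_sem G \<sigma> = Eq_set (set_sem G \<rho>)"
    and small: "small (set_sem F \<rho>)" "small (set_sem G \<rho>)"
    by blast+
  then have "rel_sem (TSum F G) \<sigma> = Eq_set (set_sem (TSum F G) \<rho>)"
    by (auto simp: Let_def Eq_set_def)
  with small show ?case
    by (simp add: small_tag[OF U])
next
  case (wf_Prod \<Gamma> \<Phi> F G)
  then have "rel_sem F \<sigma> = Eq_set (set_sem F \<rho>)" "rel_sem G \<sigma> = Eq_set (set_sem G \<rho>)"
    and small: "small (set_sem F \<rho>)" "small (set_sem G \<rho>)"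
    by blast+
  then have "rel_sem (TProd F G) \<sigma> = Eq_set (set_sem (TProd F G) \<rho>)"
    by (auto simp: Let_def Eq_set_def)
  with small show ?case
    by (simp add: small_pair[OF U])
qed

theorem theorem4p4:
  fixes \<rho> :: "'u setenv" and \<Gamma> \<Phi> :: "tyvar set" and F :: ty
  assumes "universe TYPE('u)"
    and "finite \<Gamma>" and "\<Gamma> \<subseteq> TCVars" and "finite \<Phi>" and "\<Phi> \<subseteq> FVars"
    and "set_env \<rho>"
    and "\<Gamma>; \<Phi> \<turnstile> F"
  shows "rel_sem F (Eq_env \<rho>) = Eq_set (set_sem F \<rho>)"
proof -
  \<comment> \<open>A true equality environment satisfies the exact equation everywhere; its action
    on equality relations comes from functoriality of each \<open>\<rho> v\<close>.\<close>
  have "Eq_like \<Gamma> \<Phi> \<rho> (Eq_env \<rho>)"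
    using assms(6) eq_on_eq_Eq_fun[OF assms(1)]
    by (simp add: Eq_like_def set_env_def) (simp add: Eq_env_def)
  from rel_sem_Eq_like[OF assms(1,7,3) this] show ?thesis ..
qed

end
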